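(* The canonical twisting is tight for the partition monoid $\mathcal P_n$, the Brauer monoid $\mathcal B_n$, the planar partition monoid $\mathscr P\mathcal P_n$ and the Temperley–Lieb monoid $\mathcal T\!\mathcal L_n$ ($n\geq1$), but loose for the partial Brauer monoid $\mathcal P\mathcal B_n$ and the Motzkin monoid $\mathcal M_n$ if $n\geq2$.
   Context: Write $\mathbf n=\{1,\dots,n\}$, $\mathbf n'=\{1',\dots,n'\}$, $\mathbf n''=\{1'',\dots,n''\}$ (disjoint copies). $\mathcal P_n$ is the set of all set partitions of $\mathbf n\cup\mathbf n'$. A partition is identified with any graph on $\mathbf n\cup\mathbf n'$ whose connected components are its blocks. For $a,b\in\mathcal P_n$, let $a^\vee$ be $a$ with each $x'$ renamed $x''$ and $b^\wedge$ be $b$ with each $x$ renamed $x''$; the product graph $\Pi(a,b)$ on $\mathbf n\cup\mathbf n''\cup\mathbf n'$ has as edges the union of the edges of $a^\vee$ and $b^\wedge$. The product $ab\in\mathcal P_n$ is the partition in which $x,y\in\mathbf n\cup\mathbf n'$ are in the same block iff they are in the same connected component of $\Pi(a,b)$. The canonical twisting is $\Phi(a,b)$ = the number of floating components of $\Pi(a,b)$, i.e. connected components contained in $\mathbf n''$; it is restricted to each submonoid below. Submonoids: $\mathcal B_n$ = partitions all of whose blocks have size $2$; $\mathcal P\mathcal B_n$ = partitions all of whose blocks have size $\leq2$; $\mathscr P\mathcal P_n$ = planar partitions, i.e. those whose graph can be drawn without crossings, with vertices $1<\dots<n$ on an upper row and $1'<\dots<n'$ on a lower row, all edges inside the rectangle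 bounded by the vertices; $\mathcal T\!\mathcal L_n=\mathcal B_n\cap\mathscr P\mathcal P_n$; $\mathcal M_n=\mathcal P\mathcal B_n\cap\mathscr P\mathcal P_n$. A twisting of a monoid $S$ is a map $\Phi:S\times S\to\mathbb N=\{0,1,2,\dots\}$ with $\Phi(a,b)+\Phi(ab,c)=\Phi(a,bc)+\Phi(b,c)$ for all $a,b,c\in S$ (the canonical map above is a twisting of $\mathcal P_n$, hence of any submonoid). A twisting of $S$ is tight if (a) for all $a,b\in S$ there is $a'\in S$ with $ab=a'b$ and $\Phi(a',b)=0$; and (b) for all $a,b\in S$ there is $b'\in S$ with $ab=ab'$ and $\Phi(a,b')=0$. Otherwise it is loose. *)

theory Defs
  imports "HOL-Analysis.Analysis" "HOL-Library.Disjoint_Sets"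
begin

text \<open>
  \<open>Upper i\<close>, \<open>Lower i\<close> and \<open>Middle i\<close> stand for \<open>i\<close>, \<open>i'\<close> and \<open>i''\<close>.
\<close>

datatype vertex = Upper nat | Middle nat | Lower nat

definition verts :: "nat \<Rightarrow> vertex set" where
  "verts n = Upper ` {1..n} \<union> Lower ` {1..n}"

definition partitions :: "nat \<Rightarrow> vertex set set set" where
  "partitions n = {p. partition_on (verts n) p}"

text \<open>
  Graphs are simple and undirected: a vertex set together with a set of two-element sets.
\<close>

definition components :: "'a set \<Rightarrow> 'a set set \<Rightarrow> 'a set set" where
  "components V E = V // {(u, v). u \<in> V \<and> v \<in> V \<and> (u, v) \<in> {(x, y). {x, y} \<in> E}\<^sup>*}"

definition represents :: "nat \<Rightarrow> vertex set set \<Rightarrow> vertex set set \<Rightarrow> bool" where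
  "represents n E p \<longleftrightarrow>
     E \<subseteq> {{u, v} | u v. u \<in> verts n \<and> v \<in> verts n \<and> u \<noteq> v} \<and> components (verts n) E = p"

text \<open>
  Among the graphs whose components are the blocks of a partition, the product graph below uses
  the one in which every block is a clique; the connected components do not depend on this choice.
\<close>

definition clique_edges :: "'a set set \<Rightarrow> 'a set set" where
  "clique_edges p = {{x, y} | x y B. B \<in> p \<and> x \<in> B \<and> y \<in> B \<and> x \<noteq> y}"

fun lower_to_middle :: "vertex \<Rightarrow> vertex" where
  "lower_to_middle (Lower i) = Middle i"
| "lower_to_middle v = v"

fun upper_to_middle :: "vertex \<Rightarrow> vertex" where
  "upper_to_middle (Upper i) = Middle i"
| "upper_to_middle v = v"

definition product_edges :: "vertex set set \<Rightarrow> vertex set set \<Rightarrow> vertex set set" where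
  "product_edges a b =
     clique_edges ((`) lower_to_middle ` a) \<union> clique_edges ((`) upper_to_middle ` b)"

definition product_components ::
    "nat \<Rightarrow> vertex set set \<Rightarrow> vertex set set \<Rightarrow> vertex set set" where
  "product_components n a b = components (verts n \<union> Middle ` {1..n}) (product_edges a b)"

definition pmult :: "nat \<Rightarrow> vertex set set \<Rightarrow> vertex set set \<Rightarrow> vertex set set" where
  "pmult n a b =
     verts n // {(x, y). x \<in> verts n \<and> y \<in> verts n \<and>
       (\<exists>C \<in> product_components n a b. x \<in> C \<and> y \<in> C)}"

definition canonical_twisting :: "nat \<Rightarrow> vertex set set \<Rightarrow> vertex set set \<Rightarrow> nat" where
  "canonical_twisting n a b = card {C \<in> product_components n a b. C \<subseteq> Middle ` {1..n}}"

text \<open>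
  Drawings are made in the rectangle \<open>[1,n] \<times> [0,1]\<close>, closed, so that edges may run along its
  sides. For \<open>n = 1\<close> it degenerates to a segment.
\<close>

fun position :: "vertex \<Rightarrow> real ^ 2" where
  "position (Upper i) = vector [real i, 1]"
| "position (Lower i) = vector [real i, 0]"

definition rectangle :: "nat \<Rightarrow> (real ^ 2) set" where
  "rectangle n = cbox (vector [1, 0]) (vector [real n, 1])"

definition crossing_free_drawing ::
    "nat \<Rightarrow> vertex set set \<Rightarrow> (vertex set \<Rightarrow> real \<Rightarrow> real ^ 2) \<Rightarrow> bool" where
  "crossing_free_drawing n E \<gamma> \<longleftrightarrow>
     (\<forall>e \<in> E. arc (\<gamma> e) \<and> path_image (\<gamma> e) \<subseteq> rectangle n \<and>
        {pathstart (\<gamma> e), pathfinish (\<gamma> e)} = position ` e \<and>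
        path_image (\<gamma> e) \<inter> position ` verts n = position ` e) \<and>
     (\<forall>e \<in> E. \<forall>f \<in> E. e \<noteq> f \<longrightarrow>
        path_image (\<gamma> e) \<inter> path_image (\<gamma> f) \<subseteq> position ` (e \<inter> f))"

definition planar_partitions :: "nat \<Rightarrow> vertex set set set" where
  "planar_partitions n =
     {p \<in> partitions n. \<exists>E \<gamma>. represents n E p \<and> crossing_free_drawing n E \<gamma>}"

definition brauer :: "nat \<Rightarrow> vertex set set set" where
  "brauer n = {p \<in> partitions n. \<forall>B \<in> p. card B = 2}"

definition partial_brauer :: "nat \<Rightarrow> vertex set set set" where
  "partial_brauer n = {p \<in> partitions n. \<forall>B \<in> p. card B \<le> 2}"

definition temperley_lieb :: "nat \<Rightarrow> vertex set set set" where
  "temperley_lieb n = brauer n \<inter> planar_partitions n"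

definition motzkin :: "nat \<Rightarrow> vertex set set set" where
  "motzkin n = partial_brauer n \<inter> planar_partitions n"

text \<open>
  Being tight or loose includes being a twisting.
\<close>

definition twisting :: "'s set \<Rightarrow> ('s \<Rightarrow> 's \<Rightarrow> 's) \<Rightarrow> ('s \<Rightarrow> 's \<Rightarrow> nat) \<Rightarrow> bool" where
  "twisting S m \<Phi> \<longleftrightarrow>
     (\<forall>a \<in> S. \<forall>b \<in> S. \<forall>c \<in> S. \<Phi> a b + \<Phi> (m a b) c = \<Phi> a (m b c) + \<Phi> b c)"

definition tight :: "'s set \<Rightarrow> ('s \<Rightarrow> 's \<Rightarrow> 's) \<Rightarrow> ('s \<Rightarrow> 's \<Rightarrow> nat) \<Rightarrow> bool" where
  "tight S m \<Phi> \<longleftrightarrow> twisting S m \<Phi> \<and>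
     (\<forall>a \<in> S. \<forall>b \<in> S. \<exists>a' \<in> S. m a b = m a' b \<and> \<Phi> a' b = 0) \<and>
     (\<forall>a \<in> S. \<forall>b \<in> S. \<exists>b' \<in> S. m a b = m a b' \<and> \<Phi> a b' = 0)"

definition loose :: "'s set \<Rightarrow> ('s \<Rightarrow> 's \<Rightarrow> 's) \<Rightarrow> ('s \<Rightarrow> 's \<Rightarrow> nat) \<Rightarrow> bool" where
  "loose S m \<Phi> \<longleftrightarrow> twisting S m \<Phi> \<and> \<not> tight S m \<Phi>"

end

theory Submission imports Defs begin

text \<open>
  Twisting: floating components of the product graph of three partitions can be counted by
  contracting either of the two inner rows first.

  Tightness: let \<open>C\<close> be the floating component of \<open>\<Pi>(a, b)\<close> that reaches furthest to the left, at
  \<open>i''\<close>. Read along the boundary of the rectangle, the lower vertex \<open>i'\<close> of \<open>a\<close> is preceded by a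
  vertex \<open>x\<close> (either \<open>(i-1)'\<close> or \<open>1\<close>) that does not lie in \<open>C\<close>. Merging the blocks of \<open>x\<close> and
  \<open>i'\<close> in \<open>a\<close> joins \<open>C\<close> to another component and changes nothing else, so there is one floating
  component fewer. If all blocks are pairs, \<open>{x, u}\<close> and \<open>{i', v}\<close> are replaced by \<open>{x, i'}\<close> and
  \<open>{u, v}\<close> instead, with the same effect because \<open>C\<close> is a cycle. As \<open>x\<close> and \<open>i'\<close> are neighbours,
  neither operation creates a crossing. The other half of tightness follows by turning the
  rectangle upside down.

  Looseness: let \<open>b\<close> consist of singletons and let \<open>{1, 2}\<close> be the only pair of \<open>a\<close>. If
  \<open>\<Phi>(a', b) = 0\<close>, all \<open>n\<close> lower vertices of \<open>a'\<close> are joined to upper ones, which leaves no room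
  for the pair \<open>{1, 2}\<close>.

  Planarity: polar coordinates bend the rectangle into a half annulus with all vertices on the
  real axis. There the Fashoda meet theorem shows that planar partitions are noncrossing, and half
  circles give drawings of the noncrossing ones.
\<close>

section \<open>Floating components\<close>

definition links :: "'a set set \<Rightarrow> 'a rel" where
  "links p = {(x, y). \<exists>B\<in>p. x \<in> B \<and> y \<in> B}"

text \<open>
  Classes are taken in the whole type: points outside the graph are singleton classes, which are
  not counted since \<open>M\<close> does not contain them.
\<close>

definition floating :: "'a set \<Rightarrow> 'a rel \<Rightarrow> 'a set set" where
  "floating M R = {C. C \<subseteq> M \<and> (\<exists>x. C = R\<^sup>* `` {x})}"

lemma links_sym: "sym (links p)"
  by (auto simp: links_def sym_def)

lemma finite_floating: "finite M \<Longrightarrow> finite (floating M R)"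
  by (rule finite_subset[of _ "Pow M"]) (auto simp: floating_def)

lemma class_eqI:
  assumes "sym R" "(x, y) \<in> R\<^sup>*"
  shows "R\<^sup>* `` {x} = R\<^sup>* `` {y}"
  using assms by (auto dest: symD[OF sym_rtrancl] intro: rtrancl_trans)

lemma floatingI: "R\<^sup>* `` {x} \<subseteq> M \<Longrightarrow> R\<^sup>* `` {x} \<in> floating M R"
  by (auto simp: floating_def)

lemma floatingE:
  assumes "C \<in> floating M R"
  obtains x where "C = R\<^sup>* `` {x}" "C \<subseteq> M"
  using assms by (auto simp: floating_def)

lemma rtrancl_eqI:
  assumes "R \<subseteq> S\<^sup>*" "S \<subseteq> R\<^sup>*"
  shows "R\<^sup>* = S\<^sup>*"
  using rtrancl_subset_rtrancl[OF assms(1)] rtrancl_subset_rtrancl[OF assms(2)] by blast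

text \<open>
  \<open>S'\<close> is what remains of the graph \<open>S\<close> after contracting \<open>M\<close>; reflexive pairs are left free.
\<close>

lemma contraction_rtrancl:
  assumes R: "R \<subseteq> (- M) \<times> (- M)" and S': "S' \<subseteq> (- M) \<times> (- M)"
    and star: "\<And>x y. x \<notin> M \<Longrightarrow> y \<notin> M \<Longrightarrow> (x, y) \<in> S'\<^sup>= \<longleftrightarrow> (x, y) \<in> S\<^sup>*"
    and x: "x \<notin> M"
  shows "(x, y) \<in> (R \<union> S')\<^sup>* \<longleftrightarrow> y \<notin> M \<and> (x, y) \<in> (R \<union> S)\<^sup>*"
proof
  assume xy: "(x, y) \<in> (R \<union> S')\<^sup>*"
  have "S' \<subseteq> S\<^sup>*" using S' star by blast
  hence "R \<union> S' \<subseteq> (R \<union> S)\<^sup>*"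
    using rtrancl_mono[of S "R \<union> S"] by blast
  hence "(R \<union> S')\<^sup>* \<subseteq> (R \<union> S)\<^sup>*" by (rule rtrancl_subset_rtrancl)
  moreover have "y \<notin> M" using xy x R S' by (induction) auto
  ultimately show "y \<notin> M \<and> (x, y) \<in> (R \<union> S)\<^sup>*" using xy by blast
next
  assume "y \<notin> M \<and> (x, y) \<in> (R \<union> S)\<^sup>*"
  hence y: "y \<notin> M" and xy: "(x, y) \<in> (R \<union> S)\<^sup>*" by auto
  \<comment> \<open>\<open>z\<close> is a point outside \<open>M\<close> from which the rest of the
    walk uses only edges of \<open>S\<close>; each step in \<open>R\<close> allows moving
    \<open>z\<close> to the end of that step.\<close>
  from xy have "\<exists>z. z \<notin> M \<and> (x, z) \<in> (R \<union> S')\<^sup>* \<and> (z, y) \<in> S\<^sup>*"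
  proof induction
    case base
    show ?case using x by blast
  next
    case (step y y')
    then obtain z where z: "z \<notin> M" "(x, z) \<in> (R \<union> S')\<^sup>*" "(z, y) \<in> S\<^sup>*" by blast
    show ?case
    proof (cases "(y, y') \<in> S")
      case True
      thus ?thesis using z by (meson rtrancl.rtrancl_into_rtrancl)
    next
      case False
      hence r: "(y, y') \<in> R" using step by blast
      hence "y \<notin> M" "y' \<notin> M" using R by auto
      moreover have "(z, y) \<in> S'\<^sup>=" using star z \<open>y \<notin> M\<close> by blast
      hence "(x, y) \<in> (R \<union> S')\<^sup>*" using z(2) by (auto intro: rtrancl_into_rtrancl)
      hence "(x, y') \<in> (R \<union> S')\<^sup>*" using r by (auto intro: rtrancl_into_rtrancl)
      ultimately show ?thesis by blast
    qed
  qed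
  then obtain z where z: "z \<notin> M" "(x, z) \<in> (R \<union> S')\<^sup>*" "(z, y) \<in> S\<^sup>*" by blast
  hence "(z, y) \<in> S'\<^sup>=" using star y by blast
  thus "(x, y) \<in> (R \<union> S')\<^sup>*" using z(2) by (auto intro: rtrancl_into_rtrancl)
qed

text \<open>As \<open>R\<close> does not touch \<open>M\<close>, the components inside
  \<open>M\<close> are exactly those of \<open>S\<close>. A floating component not inside
  \<open>M\<close> becomes one of the contracted graph when its points of \<open>M\<close> are
  deleted, and it is determined by what is left.\<close>

lemma floating_contraction:
  assumes sym: "sym R" "sym S" and fin: "finite M" "finite N" and MN: "M \<inter> N = {}"
    and R: "R \<subseteq> (- M) \<times> (- M)" and S': "S' \<subseteq> (- M) \<times> (- M)"
    and star: "\<And>x y. x \<notin> M \<Longrightarrow> y \<notin> M \<Longrightarrow> (x, y) \<in> S'\<^sup>= \<longleftrightarrow> (x, y) \<in> S\<^sup>*"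
  shows "card (floating (M \<union> N) (R \<union> S)) = card (floating M S) + card (floating N (R \<union> S'))"
proof -
  let ?T = "R \<union> S" and ?T' = "R \<union> S'"
  let ?F = "{C \<in> floating (M \<union> N) ?T. \<not> C \<subseteq> M}"
  have symT: "sym ?T" using sym by (rule sym_Un)
  have cl: "?T'\<^sup>* `` {x} = ?T\<^sup>* `` {x} - M" if "x \<notin> M" for x
    using contraction_rtrancl[OF R S' star that] by blast
  have in_M: "?T\<^sup>* `` {x} = S\<^sup>* `` {x}" if "S\<^sup>* `` {x} \<subseteq> M" for x
  proof -
    have "(x, y) \<in> S\<^sup>*" if "(x, y) \<in> ?T\<^sup>*" for y
      using that
    proof induction
      case (step y z)
      hence "y \<in> M" using \<open>S\<^sup>* `` {x} \<subseteq> M\<close> by blast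
      hence "(y, z) \<in> S" using step R by blast
      thus ?case using step by (meson rtrancl.rtrancl_into_rtrancl)
    qed simp
    thus ?thesis using rtrancl_mono[of S ?T] by blast
  qed
  have sub: "S\<^sup>* `` {x} \<subseteq> ?T\<^sup>* `` {x}" for x using rtrancl_mono[of S ?T] by blast
  have 1: "floating M ?T = floating M S"
  proof (intro set_eqI iffI)
    fix C assume "C \<in> floating M ?T"
    then obtain x where x: "C = ?T\<^sup>* `` {x}" "C \<subseteq> M" by (auto simp: floating_def)
    hence "C = S\<^sup>* `` {x}" using in_M[of x] sub[of x] by (metis order_trans)
    thus "C \<in> floating M S" using x by (auto simp: floating_def)
  next
    fix C assume "C \<in> floating M S"
    then obtain x where x: "C = S\<^sup>* `` {x}" "C \<subseteq> M" by (auto simp: floating_def)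
    hence "C = ?T\<^sup>* `` {x}" using in_M[of x] by metis
    thus "C \<in> floating M ?T" using x by (auto simp: floating_def)
  qed
  have mem1: "C \<in> floating M ?T \<longleftrightarrow> C \<in> floating (M \<union> N) ?T \<and> C \<subseteq> M" for C
    unfolding floating_def by blast
  have "finite ?F" using fin by (simp add: finite_floating)
  moreover have "floating (M \<union> N) ?T = floating M S \<union> ?F"
    unfolding 1[symmetric] using mem1 by blast
  moreover have "floating M S \<inter> ?F = {}" unfolding 1[symmetric] using mem1 by blast
  ultimately have 2: "card (floating (M \<union> N) ?T) = card (floating M S) + card ?F"
    using card_Un_disjoint[of "floating M S" ?F] finite_floating[OF fin(1), of S] by argo
  have "bij_betw (\<lambda>C. C - M) ?F (floating N ?T')"
  proof (rule bij_betwI')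
    fix C D assume C: "C \<in> ?F" and D: "D \<in> ?F"
    show "C - M = D - M \<longleftrightarrow> C = D"
    proof
      assume eq: "C - M = D - M"
      obtain x where x: "C = ?T\<^sup>* `` {x}" using C by (blast elim: floatingE)
      obtain y where y: "D = ?T\<^sup>* `` {y}" using D by (blast elim: floatingE)
      obtain z where "z \<in> C" "z \<in> D" using C eq by blast
      hence "(x, z) \<in> ?T\<^sup>*" "(y, z) \<in> ?T\<^sup>*" unfolding x y by simp_all
      thus "C = D" using x y class_eqI[OF symT] by metis
    qed simp
  next
    fix C assume C: "C \<in> ?F"
    then obtain x where x: "C = ?T\<^sup>* `` {x}" "C \<subseteq> M \<union> N" by (blast elim: floatingE)
    obtain z where z: "z \<in> C" "z \<notin> M" using C by blast
    hence "(x, z) \<in> ?T\<^sup>*" unfolding x by simp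
    hence "C = ?T\<^sup>* `` {z}" using x class_eqI[OF symT] by metis
    hence "C - M = ?T'\<^sup>* `` {z}" using cl[OF z(2)] by simp
    moreover have "C - M \<subseteq> N" using x(2) by blast
    ultimately show "C - M \<in> floating N ?T'" using floatingI by metis
  next
    fix C assume "C \<in> floating N ?T'"
    then obtain x where x: "C = ?T'\<^sup>* `` {x}" "C \<subseteq> N" by (rule floatingE)
    hence xM: "x \<notin> M" using MN by blast
    have C: "C = ?T\<^sup>* `` {x} - M" using x cl[OF xM] by simp
    hence "?T\<^sup>* `` {x} \<subseteq> M \<union> N" using x(2) by blast
    hence "?T\<^sup>* `` {x} \<in> floating (M \<union> N) ?T" by (rule floatingI)
    moreover have "x \<in> ?T\<^sup>* `` {x}" by simp
    ultimately show "\<exists>D\<in>?F. C = D - M" using C xM by blast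
  qed
  from bij_betw_same_card[OF this] 2 show ?thesis by simp
qed

lemma rtrancl_map_prod_iff:
  assumes "inj f"
  shows "(f x, y) \<in> (map_prod f f ` R)\<^sup>* \<longleftrightarrow> (\<exists>z. y = f z \<and> (x, z) \<in> R\<^sup>*)"
proof
  assume "(f x, y) \<in> (map_prod f f ` R)\<^sup>*"
  thus "\<exists>z. y = f z \<and> (x, z) \<in> R\<^sup>*"
  proof induction
    case (step y z)
    then show ?case using assms
      by (metis (no_types, lifting) Pair_inject image_iff inj_eq map_prod_imageI prod_fun_imageE rtrancl.rtrancl_into_rtrancl)
  qed auto
next
  have "(f x, f z) \<in> (map_prod f f ` R)\<^sup>*" if "(x, z) \<in> R\<^sup>*" for z
    using that by induction (auto intro: rtrancl_into_rtrancl)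
  thus "\<exists>z. y = f z \<and> (x, z) \<in> R\<^sup>* \<Longrightarrow> (f x, y) \<in> (map_prod f f ` R)\<^sup>*" by blast
qed

text \<open>Serves two relabellings: the embedding of product graphs into rows by
  \<open>layer\<close>, and the reflection \<open>flip\<close>.\<close>

lemma card_floating_map:
  assumes "inj f"
  shows "card (floating (f ` M) (map_prod f f ` R)) = card (floating M R)"
proof -
  let ?R = "map_prod f f ` R"
  have cl: "?R\<^sup>* `` {f x} = f ` (R\<^sup>* `` {x})" for x
    using rtrancl_map_prod_iff[OF assms, of x _ R] by (auto simp: image_iff)
  have "floating (f ` M) ?R = (`) f ` floating M R"
  proof
    show "floating (f ` M) ?R \<subseteq> (`) f ` floating M R"
    proof
      fix C assume "C \<in> floating (f ` M) ?R"
      then obtain y where y: "C = ?R\<^sup>* `` {y}" "C \<subseteq> f ` M" by (auto simp: floating_def)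
      then obtain x where "y = f x" by blast
      hence "C = f ` (R\<^sup>* `` {x})" using y cl by simp
      thus "C \<in> (`) f ` floating M R"
        using y(2) inj_image_subset_iff[OF assms] by (auto simp: floating_def)
    qed
    show "(`) f ` floating M R \<subseteq> floating (f ` M) ?R"
      by (auto simp: floating_def cl[symmetric])
  qed
  moreover have "inj_on ((`) f) (floating M R)"
    using assms by (meson inj_image_eq_iff inj_onI)
  ultimately show ?thesis by (simp add: card_image)
qed

section \<open>The product graph\<close>

text \<open>Ordered pairs, loops included, in place of two-element edges: connectedness becomes
  reflexive transitive closure.\<close>

definition product_rel :: "vertex set set \<Rightarrow> vertex set set \<Rightarrow> vertex rel" where
  "product_rel a b = map_prod lower_to_middle lower_to_middle ` links a \<union>
     map_prod upper_to_middle upper_to_middle ` links b"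

lemma partitionsD:
  assumes "a \<in> partitions n"
  shows "partition_on (verts n) a" "equiv (verts n) (links a)" "links a \<subseteq> verts n \<times> verts n"
proof -
  show p: "partition_on (verts n) a" using assms by (simp add: partitions_def)
  show "equiv (verts n) (links a)" unfolding links_def using equiv_partition_on[OF p] by simp
  thus "links a \<subseteq> verts n \<times> verts n" by (rule equiv_type)
qed

lemma links_quotient:
  assumes "equiv A R"
  shows "links (A // R) = R"
proof (intro set_eqI iffI)
  fix z assume "z \<in> links (A // R)"
  then obtain x y B where "z = (x, y)" "B \<in> A // R" "x \<in> B" "y \<in> B" by (auto simp: links_def)
  thus "z \<in> R" using assms by (simp add: in_quotient_imp_in_rel)
next
  fix z assume z: "z \<in> R"
  then obtain x y where xy: "z = (x, y)" by fastforce
  hence "x \<in> A" using z assms by (meson equiv_class_eq_iff)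
  hence "R `` {x} \<in> A // R" "x \<in> R `` {x}" using assms
    by (auto intro: quotientI dest: equiv_class_self)
  thus "z \<in> links (A // R)" using xy z by (auto simp: links_def)
qed

text \<open>Clique edges and links differ only in diagonal pairs, which the closure adds on both
  sides.\<close>

lemma rtrancl_clique_edges:
  fixes f g :: "'a \<Rightarrow> 'b"
  shows "{(x, y). {x, y} \<in> clique_edges ((`) f ` p) \<union> clique_edges ((`) g ` q)}\<^sup>* =
     (map_prod f f ` links p \<union> map_prod g g ` links q)\<^sup>*"
proof -
  have *: "{x, y} \<in> clique_edges ((`) h ` r) \<longleftrightarrow> x \<noteq> y \<and> (x, y) \<in> map_prod h h ` links r"
    for x y :: 'b and h :: "'a \<Rightarrow> 'b" and r
  proof
    assume "{x, y} \<in> clique_edges ((`) h ` r)"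
    then obtain u v B where "{x, y} = {u, v}" "B \<in> r" "u \<in> h ` B" "v \<in> h ` B" "u \<noteq> v"
      by (auto simp: clique_edges_def)
    hence "x \<noteq> y" "x \<in> h ` B" "y \<in> h ` B" "B \<in> r" by (auto simp: doubleton_eq_iff)
    thus "x \<noteq> y \<and> (x, y) \<in> map_prod h h ` links r" by (force simp: links_def)
  next
    assume "x \<noteq> y \<and> (x, y) \<in> map_prod h h ` links r"
    then obtain B where "x \<noteq> y" "B \<in> r" "x \<in> h ` B" "y \<in> h ` B" by (auto simp: links_def)
    thus "{x, y} \<in> clique_edges ((`) h ` r)" by (auto simp: clique_edges_def)
  qed
  have "{(x, y). {x, y} \<in> clique_edges ((`) f ` p) \<union> clique_edges ((`) g ` q)} =
      (map_prod f f ` links p \<union> map_prod g g ` links q) - Id"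
    (is "?L = ?R")
  proof (intro set_eqI)
    fix z :: "'b \<times> 'b"
    obtain x y where z: "z = (x, y)" by (cases z)
    show "z \<in> ?L \<longleftrightarrow> z \<in> ?R"
      unfolding z mem_Collect_eq case_prod_conv Un_iff Diff_iff pair_in_Id_conv * by argo
  qed
  thus ?thesis by (simp add: rtrancl_r_diff_Id)
qed

lemma components_eq:
  assumes "{(x, y). {x, y} \<in> E}\<^sup>* = R\<^sup>*" "R \<subseteq> V \<times> V"
  shows "components V E = (\<lambda>x. R\<^sup>* `` {x}) ` V"
proof -
  have "y \<in> V" if "(x, y) \<in> R\<^sup>*" "x \<in> V" for x y
    using that assms(2) by induction auto
  hence "{(u, v). u \<in> V \<and> v \<in> V \<and> (u, v) \<in> R\<^sup>*} `` {x} = R\<^sup>* `` {x}" if "x \<in> V" for x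
    using that by auto
  thus ?thesis by (auto simp: components_def assms(1) quotient_def)
qed

lemma map_prod_image_subset:
  assumes "R \<subseteq> A \<times> A" "\<And>v. v \<in> A \<Longrightarrow> f v \<in> B"
  shows "map_prod f f ` R \<subseteq> B \<times> B"
  using assms by auto

lemma product_rel_sub:
  assumes "links a \<subseteq> verts n \<times> verts n" "links b \<subseteq> verts n \<times> verts n"
  shows "product_rel a b \<subseteq> (verts n \<union> Middle ` {1..n}) \<times> (verts n \<union> Middle ` {1..n})"
proof -
  have "lower_to_middle v \<in> verts n \<union> Middle ` {1..n}" "upper_to_middle v \<in> verts n \<union> Middle ` {1..n}"
    if "v \<in> verts n" for v using that by (auto simp: verts_def)
  thus ?thesis unfolding product_rel_def using assms
    by (intro Un_least map_prod_image_subset[of _ "verts n"])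
qed

lemma sym_map_prod: "sym R \<Longrightarrow> sym (map_prod f f ` R)"
  by (auto simp: sym_def)

lemma sym_product_rel: "sym (product_rel a b)"
  unfolding product_rel_def by (intro sym_Un sym_map_prod links_sym)

context
  fixes n a b
  assumes ab: "a \<in> partitions n" "b \<in> partitions n"
begin

lemma product_rel_subset: "product_rel a b \<subseteq> (verts n \<union> Middle ` {1..n}) \<times> (verts n \<union> Middle ` {1..n})"
  using ab by (intro product_rel_sub partitionsD)

lemma product_components_eq:
  "product_components n a b = (\<lambda>x. (product_rel a b)\<^sup>* `` {x}) ` (verts n \<union> Middle ` {1..n})"
  unfolding product_components_def
  by (intro components_eq product_rel_subset)
     (simp only: product_edges_def product_rel_def rtrancl_clique_edges)

lemma canonical_twisting_eq:
  "canonical_twisting n a b = card (floating (Middle ` {1..n}) (product_rel a b))"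
proof -
  have "{C \<in> product_components n a b. C \<subseteq> Middle ` {1..n}} = floating (Middle ` {1..n}) (product_rel a b)"
    unfolding product_components_eq floating_def by blast
  thus ?thesis by (simp add: canonical_twisting_def)
qed

lemma pmult_eq:
  "pmult n a b = verts n // {(x, y). x \<in> verts n \<and> y \<in> verts n \<and> (x, y) \<in> (product_rel a b)\<^sup>*}"
proof -
  have "(\<exists>C\<in>product_components n a b. x \<in> C \<and> y \<in> C) \<longleftrightarrow> (x, y) \<in> (product_rel a b)\<^sup>*"
    if "x \<in> verts n" for x y
    using that unfolding product_components_eq
    by (auto dest: symD[OF sym_rtrancl[OF sym_product_rel]] intro: rtrancl_trans)
  hence "{(x, y). x \<in> verts n \<and> y \<in> verts n \<and> (\<exists>C\<in>product_components n a b. x \<in> C \<and> y \<in> C)} =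
    {(x, y). x \<in> verts n \<and> y \<in> verts n \<and> (x, y) \<in> (product_rel a b)\<^sup>*}" by blast
  thus ?thesis by (simp add: pmult_def)
qed

lemma equiv_pmult: "equiv (verts n) {(x, y). x \<in> verts n \<and> y \<in> verts n \<and> (x, y) \<in> (product_rel a b)\<^sup>*}"
  by (intro equivI refl_onI symI transI)
     (auto dest: symD[OF sym_rtrancl[OF sym_product_rel]] intro: rtrancl_trans)

lemma pmult_partitions: "pmult n a b \<in> partitions n"
  unfolding pmult_eq partitions_def using partition_on_quotient[OF equiv_pmult] by simp

lemma links_pmult:
  "links (pmult n a b) = {(x, y). x \<in> verts n \<and> y \<in> verts n \<and> (x, y) \<in> (product_rel a b)\<^sup>*}"
  unfolding pmult_eq by (rule links_quotient[OF equiv_pmult])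

end

section \<open>Stacking three partitions: the twisting identity\<close>

text \<open>
  \<open>layer p q r\<close> puts the upper, middle and lower row at heights \<open>p\<close>, \<open>q\<close> and \<open>r\<close>, so that the
  product graph of three partitions can be formed on the heights 0, 1, 2, 3.
\<close>

fun layer :: "nat \<Rightarrow> nat \<Rightarrow> nat \<Rightarrow> vertex \<Rightarrow> nat \<times> nat" where
  "layer p q r (Upper i) = (p, i)"
| "layer p q r (Middle i) = (q, i)"
| "layer p q r (Lower i) = (r, i)"

text \<open>The middle argument of \<open>layer\<close> is the default \<open>p\<close>, as blocks
  of a partition contain no middle vertices.\<close>

definition place :: "nat \<Rightarrow> nat \<Rightarrow> vertex set set \<Rightarrow> (nat \<times> nat) rel" where
  "place p q a = map_prod (layer p p q) (layer p p q) ` links a"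

lemma inj_layer: "p \<noteq> q \<Longrightarrow> q \<noteq> r \<Longrightarrow> p \<noteq> r \<Longrightarrow> inj (layer p q r)"
proof (rule injI)
  fix x y
  assume "p \<noteq> q" "q \<noteq> r" "p \<noteq> r" "layer p q r x = layer p q r y"
  thus "x = y" by (cases x; cases y) auto
qed

lemma map_prod_links_comp:
  assumes "links a \<subseteq> verts n \<times> verts n" "\<And>v. v \<in> verts n \<Longrightarrow> h (f v) = k v"
  shows "map_prod h h ` map_prod f f ` links a = map_prod k k ` links a"
  unfolding image_image using assms by (intro image_cong refl) auto

lemma map_product_rel:
  assumes "a \<in> partitions n" "b \<in> partitions n"
  shows "map_prod (layer p q r) (layer p q r) ` product_rel a b = place p q a \<union> place q r b"
proof -
  have "map_prod (layer p q r) (layer p q r) ` map_prod lower_to_middle lower_to_middle ` links a = place p q a"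
    unfolding place_def by (rule map_prod_links_comp[OF partitionsD(3)[OF assms(1)]]) (auto simp: verts_def)
  moreover have "map_prod (layer p q r) (layer p q r) ` map_prod upper_to_middle upper_to_middle ` links b = place q r b"
    unfolding place_def by (rule map_prod_links_comp[OF partitionsD(3)[OF assms(2)]]) (auto simp: verts_def)
  ultimately show ?thesis by (simp only: product_rel_def image_Un)
qed

lemma canonical_twisting_layers:
  assumes ab: "a \<in> partitions n" "b \<in> partitions n" and pqr: "p \<noteq> q" "q \<noteq> r" "p \<noteq> r"
  shows "canonical_twisting n a b = card (floating ({q} \<times> {1..n}) (place p q a \<union> place q r b))"
proof -
  have "layer p q r ` Middle ` {1..n} = {q} \<times> {1..n}" by (auto simp: image_image)
  thus ?thesis
    unfolding canonical_twisting_eq[OF ab]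
    using card_floating_map[OF inj_layer[OF pqr], of "Middle ` {1..n}" "product_rel a b"]
    by (simp add: map_product_rel[OF ab])
qed

lemma place_subset:
  assumes "a \<in> partitions n"
  shows "place p q a \<subseteq> ({p, q} \<times> {1..n}) \<times> ({p, q} \<times> {1..n})"
proof -
  have "layer p p q v \<in> {p, q} \<times> {1..n}" if "v \<in> verts n" for v
    using that by (auto simp: verts_def)
  thus ?thesis unfolding place_def by (rule map_prod_image_subset[OF partitionsD(3)[OF assms]])
qed

lemma sym_place: "sym (place p q a)"
  unfolding place_def by (intro sym_map_prod links_sym)

text \<open>This is the hypothesis \<open>star\<close> of \<open>floating_contraction\<close>:
  replacing two stacked partitions by their product contracts the row between them. The reflexive
  closure accounts for points outside the rows.\<close>

lemma place_pmult:
  assumes ab: "a \<in> partitions n" "b \<in> partitions n" and pqr: "p \<noteq> q" "q \<noteq> r" "p \<noteq> r"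
    and xy: "x \<notin> {q} \<times> {1..n}" "y \<notin> {q} \<times> {1..n}"
  shows "(x, y) \<in> (place p r (pmult n a b))\<^sup>= \<longleftrightarrow> (x, y) \<in> (place p q a \<union> place q r b)\<^sup>*"
proof
  assume "(x, y) \<in> (place p r (pmult n a b))\<^sup>="
  moreover have "(x, y) \<in> (place p q a \<union> place q r b)\<^sup>*" if xy0: "(x, y) \<in> place p r (pmult n a b)"
  proof -
    obtain w where w: "(x, y) = map_prod (layer p p r) (layer p p r) w" "w \<in> links (pmult n a b)"
      using xy0 unfolding place_def by (rule imageE)
    obtain u v where "w = (u, v)" by (cases w)
    with w have uv: "x = layer p p r u" "y = layer p p r v" "(u, v) \<in> links (pmult n a b)"
      by simp_all
    hence "u \<in> verts n" "v \<in> verts n" "(u, v) \<in> (product_rel a b)\<^sup>*"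
      by (simp_all add: links_pmult[OF ab])
    moreover from this have "x = layer p q r u" "y = layer p q r v" using uv by (auto simp: verts_def)
    ultimately show ?thesis
      using rtrancl_map_prod_iff[OF inj_layer[OF pqr], of u y "product_rel a b"]
      by (auto simp: map_product_rel[OF ab])
  qed
  ultimately show "(x, y) \<in> (place p q a \<union> place q r b)\<^sup>*" by auto
next
  let ?S = "place p q a \<union> place q r b"
  assume xy': "(x, y) \<in> ?S\<^sup>*"
  show "(x, y) \<in> (place p r (pmult n a b))\<^sup>="
  proof (cases "x = y")
    case False
    have sub: "?S \<subseteq> ({p, q, r} \<times> {1..n}) \<times> ({p, q, r} \<times> {1..n})"
      using place_subset[OF ab(1), of p q] place_subset[OF ab(2), of q r] by blast
    have layer_ex: "\<exists>u\<in>verts n. w = layer p q r u \<and> w = layer p p r u"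
      if "w \<in> {p, q, r} \<times> {1..n}" "w \<notin> {q} \<times> {1..n}" for w
    proof -
      obtain k i where "w = (k, i)" by (cases w)
      hence "w = (p, i) \<or> w = (r, i)" "i \<in> {1..n}" using that by auto
      hence "w = layer p q r (Upper i) \<and> w = layer p p r (Upper i) \<or>
          w = layer p q r (Lower i) \<and> w = layer p p r (Lower i)"
        and "Upper i \<in> verts n" "Lower i \<in> verts n" by (auto simp: verts_def)
      thus ?thesis by blast
    qed
    \<comment> \<open>A walk between different points has an edge at either end, so both ends lie in
      one of the three rows.\<close>
    have "(x, y) \<in> ?S\<^sup>+" using xy' False by (simp add: rtrancl_eq_or_trancl)
    hence "(x, y) \<in> ({p, q, r} \<times> {1..n}) \<times> ({p, q, r} \<times> {1..n})"
      using trancl_subset_Sigma[OF sub] by blast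
    hence "x \<in> {p, q, r} \<times> {1..n}" "y \<in> {p, q, r} \<times> {1..n}" by simp_all
    then obtain u v where u: "x = layer p q r u" "x = layer p p r u" "u \<in> verts n"
      and v: "y = layer p q r v" "y = layer p p r v" "v \<in> verts n"
      using layer_ex[OF _ xy(1)] layer_ex[OF _ xy(2)] by blast
    have "(u, v) \<in> (product_rel a b)\<^sup>*"
      using xy' rtrancl_map_prod_iff[OF inj_layer[OF pqr], of u y "product_rel a b"]
        inj_layer[OF pqr] u v by (auto simp: map_product_rel[OF ab] dest: injD)
    hence "(u, v) \<in> links (pmult n a b)" using u v by (simp add: links_pmult[OF ab])
    hence "(x, y) \<in> place p r (pmult n a b)" unfolding u(2) v(2) place_def by blast
    thus ?thesis by simp
  qed simp
qed

lemma twisting_canonical: "twisting (partitions n) (pmult n) (canonical_twisting n)"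
  unfolding twisting_def
proof (intro ballI)
  fix a b c assume abc: "a \<in> partitions n" "b \<in> partitions n" "c \<in> partitions n"
  note [simp] = pmult_partitions[OF abc(1,2)] pmult_partitions[OF abc(2,3)] abc
  let ?L = "\<lambda>k::nat. {k} \<times> {1..n}"
  have off: "place p q d \<subseteq> (- ?L k) \<times> (- ?L k)" if "d \<in> partitions n" "p \<noteq> k" "q \<noteq> k" for p q k d
    using place_subset[OF that(1), of p q] that(2,3) by blast
  \<comment> \<open>With \<open>a\<close>, \<open>b\<close>, \<open>c\<close> stacked between
    heights 0, 1, 2, 3, the inner rows have heights 1 and 2. Contracting row 1 first yields one side
    of the identity, contracting row 2 first the other; the total is the same.\<close>
  have "card (floating (?L 1 \<union> ?L 2) (place 2 3 c \<union> (place 0 1 a \<union> place 1 2 b))) =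
      card (floating (?L 1) (place 0 1 a \<union> place 1 2 b)) +
      card (floating (?L 2) (place 2 3 c \<union> place 0 2 (pmult n a b)))"
    by (rule floating_contraction[OF sym_place sym_Un[OF sym_place sym_place] _ _ _ off off place_pmult];
        (assumption | (simp; fail) | (auto; fail)))
  moreover have "card (floating (?L 2 \<union> ?L 1) (place 0 1 a \<union> (place 1 2 b \<union> place 2 3 c))) =
      card (floating (?L 2) (place 1 2 b \<union> place 2 3 c)) +
      card (floating (?L 1) (place 0 1 a \<union> place 1 3 (pmult n b c)))"
    by (rule floating_contraction[OF sym_place sym_Un[OF sym_place sym_place] _ _ _ off off place_pmult];
        (assumption | (simp; fail) | (auto; fail)))
  ultimately show "canonical_twisting n a b + canonical_twisting n (pmult n a b) c =
      canonical_twisting n a (pmult n b c) + canonical_twisting n b c"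
    by (simp add: canonical_twisting_layers[of a n b 0 1 2] canonical_twisting_layers[of b n c 1 2 3]
        canonical_twisting_layers[of "pmult n a b" n c 0 2 3]
        canonical_twisting_layers[of a n "pmult n b c" 0 1 3] Un_ac)
qed

section \<open>Joining a floating component to another component\<close>

text \<open>A walk through the new edge has both ends in the old classes of \<open>x\<close> and
  \<open>y\<close>, and the edge fuses these into one class.\<close>

lemma rtrancl_insert_edge:
  assumes "sym R"
  shows "(u, v) \<in> (R \<union> {(x, y), (y, x)})\<^sup>* \<longleftrightarrow>
    (u, v) \<in> R\<^sup>* \<or> u \<in> R\<^sup>* `` {x, y} \<and> v \<in> R\<^sup>* `` {x, y}"
    (is "_ \<in> ?T\<^sup>* \<longleftrightarrow> _")
proof
  have symR: "(s, t) \<in> R\<^sup>* \<Longrightarrow> (t, s) \<in> R\<^sup>*" for s t using assms by (meson symD sym_rtrancl)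
  {
    assume "(u, v) \<in> ?T\<^sup>*"
    thus "(u, v) \<in> R\<^sup>* \<or> u \<in> R\<^sup>* `` {x, y} \<and> v \<in> R\<^sup>* `` {x, y}"
    proof induction
      case (step v w)
      show ?case
      proof (cases "(v, w) \<in> R")
        case True
        thus ?thesis using step.IH by (auto intro: rtrancl_into_rtrancl)
      next
        case False
        hence "v \<in> {x, y}" "w \<in> {x, y}" using step.hyps(2) by auto
        thus ?thesis using step.IH symR by blast
      qed
    qed simp
  }
  assume "(u, v) \<in> R\<^sup>* \<or> u \<in> R\<^sup>* `` {x, y} \<and> v \<in> R\<^sup>* `` {x, y}"
  moreover have RT: "R\<^sup>* \<subseteq> ?T\<^sup>*" by (rule rtrancl_mono) blast
  moreover have "(u, v) \<in> ?T\<^sup>*" if "s \<in> {x, y}" "t \<in> {x, y}" "(s, u) \<in> R\<^sup>*" "(t, v) \<in> R\<^sup>*" for s t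
  proof -
    have "(u, s) \<in> ?T\<^sup>*" "(t, v) \<in> ?T\<^sup>*" using that symR RT by blast+
    moreover have "(s, t) \<in> ?T\<^sup>*" using that(1,2) by auto
    ultimately show ?thesis by (meson rtrancl_trans)
  qed
  ultimately show "(u, v) \<in> ?T\<^sup>*" by blast
qed

text \<open>The class of \<open>y\<close> floats and is fused with that of \<open>x\<close>. The
  fused class floats if and only if the class of \<open>x\<close> did, so the count drops by one;
  outside \<open>M\<close> the fused class has the same points as the class of
  \<open>x\<close>.\<close>

lemma card_floating_insert_edge:
  assumes "sym R" "finite M" and y: "R\<^sup>* `` {y} \<subseteq> M" and xy: "(y, x) \<notin> R\<^sup>*"
    and R': "R'\<^sup>* = (R \<union> {(x, y), (y, x)})\<^sup>*"
  shows "card (floating M R) = Suc (card (floating M R'))"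
    and "\<And>u v. u \<notin> M \<Longrightarrow> v \<notin> M \<Longrightarrow> (u, v) \<in> R'\<^sup>* \<longleftrightarrow> (u, v) \<in> R\<^sup>*"
proof -
  let ?X = "R\<^sup>* `` {x}" and ?Y = "R\<^sup>* `` {y}"
  note edge = rtrancl_insert_edge[OF assms(1), of _ _ x y, folded R']
  have symR: "(s, t) \<in> R\<^sup>* \<Longrightarrow> (t, s) \<in> R\<^sup>*" for s t using assms(1) by (meson symD sym_rtrancl)
  have tr: "(s, t) \<in> R\<^sup>* \<Longrightarrow> (t, r) \<in> R\<^sup>* \<Longrightarrow> (s, r) \<in> R\<^sup>*" for s t r by (rule rtrancl_trans)
  have XY: "?X \<inter> ?Y = {}" using xy symR tr by blast
  have R'_in: "R'\<^sup>* `` {u} = ?X \<union> ?Y" if "u \<in> ?X \<union> ?Y" for u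
    using that edge symR tr by blast
  have R'_out: "R'\<^sup>* `` {u} = R\<^sup>* `` {u}" if "u \<notin> ?X \<union> ?Y" for u
    using that edge by blast
  have disj: "R\<^sup>* `` {u} = ?X \<or> u \<notin> ?X" "R\<^sup>* `` {u} = ?Y \<or> u \<notin> ?Y" for u
    using symR tr by blast+
  show "(u, v) \<in> R'\<^sup>* \<longleftrightarrow> (u, v) \<in> R\<^sup>*" if "u \<notin> M" "v \<notin> M" for u v
  proof -
    have "u \<notin> ?Y" "v \<notin> ?Y" using that y by auto
    thus ?thesis using edge[of u v] symR tr by blast
  qed
  \<comment> \<open>With the class of \<open>y\<close> dropped, the class of \<open>x\<close>, if it
    floats, is matched with the fused class; all others stay.\<close>
  let ?f = "\<lambda>C. if C = ?X then ?X \<union> ?Y else C"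
  have ex: "\<exists>u. C = R\<^sup>* `` {u} \<and> u \<notin> ?X \<union> ?Y"
    if C: "C \<in> floating M R" "C \<noteq> ?X" "C \<noteq> ?Y" for C
  proof -
    obtain u where u: "C = R\<^sup>* `` {u}" using C(1) by (rule floatingE)
    with C disj[of u] show ?thesis by blast
  qed
  have bij: "bij_betw ?f (floating M R - {?Y}) (floating M R')"
  proof (rule bij_betwI')
    fix C D assume C: "C \<in> floating M R - {?Y}" and D: "D \<in> floating M R - {?Y}"
    have "E \<noteq> ?X \<union> ?Y" if E: "E \<in> floating M R - {?Y}" "E \<noteq> ?X" for E
    proof -
      obtain u where "E = R\<^sup>* `` {u}" "u \<notin> ?X \<union> ?Y" using ex[of E] E by blast
      thus ?thesis by blast
    qed
    thus "?f C = ?f D \<longleftrightarrow> C = D" using C D by auto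
  next
    fix C assume C: "C \<in> floating M R - {?Y}"
    hence CM: "C \<subseteq> M" by (auto elim: floatingE)
    show "?f C \<in> floating M R'"
    proof (cases "C = ?X")
      case True
      hence "R'\<^sup>* `` {x} \<subseteq> M" using CM y R'_in[of x] by simp
      hence "R'\<^sup>* `` {x} \<in> floating M R'" by (rule floatingI)
      thus ?thesis using True R'_in[of x] by simp
    next
      case False
      then obtain u where u: "C = R\<^sup>* `` {u}" "u \<notin> ?X \<union> ?Y" using ex[of C] C by blast
      hence C': "C = R'\<^sup>* `` {u}" using R'_out[OF u(2)] by simp
      have "C \<in> floating M R'" using CM unfolding C' by (rule floatingI)
      thus ?thesis using False by simp
    qed
  next
    fix C assume "C \<in> floating M R'"
    then obtain u where u: "C = R'\<^sup>* `` {u}" "C \<subseteq> M" by (rule floatingE)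
    show "\<exists>D\<in>floating M R - {?Y}. C = ?f D"
    proof (cases "u \<in> ?X \<union> ?Y")
      case True
      hence C: "C = ?X \<union> ?Y" using u R'_in by simp
      hence "?X \<in> floating M R" using u(2) by (intro floatingI) simp
      moreover have "?X \<noteq> ?Y" using XY by blast
      ultimately show ?thesis using C by (intro bexI[of _ ?X]) auto
    next
      case False
      hence C: "C = R\<^sup>* `` {u}" using u R'_out by simp
      moreover have "C \<in> floating M R" using u(2) unfolding C by (rule floatingI)
      moreover have "C \<noteq> ?X" "C \<noteq> ?Y" using C False by blast+
      ultimately show ?thesis by (intro bexI[of _ C]) auto
    qed
  qed
  have "?Y \<in> floating M R" using y by (rule floatingI)
  with finite_floating[OF assms(2)]
  have "card (floating M R) = Suc (card (floating M R - {?Y}))" by (rule card.remove)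
  thus "card (floating M R) = Suc (card (floating M R'))"
    unfolding bij_betw_same_card[OF bij] .
qed

text \<open>
  The order of the vertices along the boundary of the rectangle, cut open on its right side.
\<close>

fun vertex_order :: "vertex \<Rightarrow> int" where
  "vertex_order (Upper i) = - int i"
| "vertex_order (Middle i) = 0"
| "vertex_order (Lower i) = int i"

text \<open>The classical noncrossing set partitions of a linearly ordered set: different blocks
  never interleave.\<close>

definition noncrossing :: "vertex set set \<Rightarrow> bool" where
  "noncrossing a \<longleftrightarrow> (\<forall>p q r s. vertex_order p < vertex_order q \<longrightarrow> vertex_order q < vertex_order r \<longrightarrow>
     vertex_order r < vertex_order s \<longrightarrow> (p, r) \<in> links a \<longrightarrow> (q, s) \<in> links a \<longrightarrow> (p, q) \<in> links a)"

text \<open>At the left side \<open>Upper 1\<close> and \<open>Lower 1\<close> are neighbours; at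
  the right side, where the boundary is cut, \<open>Upper n\<close> and \<open>Lower n\<close> are
  not if \<open>n\<close> is at least 2.\<close>

definition consecutive :: "nat \<Rightarrow> vertex \<Rightarrow> vertex \<Rightarrow> bool" where
  "consecutive n x y \<longleftrightarrow> x \<in> verts n \<and> y \<in> verts n \<and> vertex_order x < vertex_order y \<and>
     (\<forall>w\<in>verts n. \<not> (vertex_order x < vertex_order w \<and> vertex_order w < vertex_order y))"

lemma inj_on_vertex_order: "inj_on vertex_order (verts n)"
  by (auto simp: inj_on_def verts_def)

section \<open>Merging the blocks of two neighbouring vertices\<close>

definition merge_blocks :: "'a set set \<Rightarrow> 'a \<Rightarrow> 'a \<Rightarrow> 'a set set" where
  "merge_blocks a x y = insert (links a `` {x, y}) (a - {links a `` {x}, links a `` {y}})"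

lemma linksI: "B \<in> p \<Longrightarrow> x \<in> B \<Longrightarrow> y \<in> B \<Longrightarrow> (x, y) \<in> links p"
  by (auto simp: links_def)

lemma links_class:
  assumes "partition_on V a" "B \<in> a" "x \<in> B"
  shows "links a `` {x} = B"
proof -
  have "C = B" if "C \<in> a" "x \<in> C" for C
    using assms that unfolding partition_on_def disjoint_def by blast
  thus ?thesis using assms(2,3) unfolding links_def by blast
qed

lemma class_mem:
  assumes "partition_on V a" "x \<in> V"
  shows "links a `` {x} \<in> a"
proof -
  obtain B where "B \<in> a" "x \<in> B" using assms by (auto simp: partition_on_def)
  thus ?thesis using links_class[OF assms(1)] by metis
qed

lemma partition_on_union_blocks:
  assumes a: "partition_on V a" and AB: "A \<in> a" "B \<in> a"
  shows "partition_on V (insert (A \<union> B) (a - {A, B}))"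
proof -
  have U: "\<Union>a = V" and disj: "\<And>C D. C \<in> a \<Longrightarrow> D \<in> a \<Longrightarrow> C \<noteq> D \<Longrightarrow> C \<inter> D = {}" and ne: "{} \<notin> a"
    using a by (auto simp: partition_on_def disjoint_def)
  have off: "(A \<union> B) \<inter> D = {}" if "D \<in> a - {A, B}" for D
    using that disj[OF AB(1), of D] disj[OF AB(2), of D] by blast
  show ?thesis
  proof (rule partition_onI)
    show "\<Union> (insert (A \<union> B) (a - {A, B})) = V" using U AB by blast
    show "{} \<notin> insert (A \<union> B) (a - {A, B})" using AB(1) ne by auto
    show "disjnt p q" if pq: "p \<in> insert (A \<union> B) (a - {A, B})" "q \<in> insert (A \<union> B) (a - {A, B})" "p \<noteq> q" for p q
    proof -
      consider "p = A \<union> B" "q \<in> a - {A, B}" | "q = A \<union> B" "p \<in> a - {A, B}" | "p \<in> a" "q \<in> a"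
        using pq by blast
      thus ?thesis
        using off disj pq(3) by cases (auto simp: disjnt_def Int_commute)
    qed
  qed
qed

lemma merge_partition:
  assumes a: "partition_on V a" and xy: "x \<in> V" "y \<in> V"
  shows "partition_on V (merge_blocks a x y)"
proof -
  have "links a `` {x, y} = links a `` {x} \<union> links a `` {y}" by blast
  thus ?thesis
    using partition_on_union_blocks[OF a class_mem[OF a xy(1)] class_mem[OF a xy(2)]]
    by (simp only: merge_blocks_def)
qed

lemma links_insert: "links (insert B a) = links a \<union> B \<times> B"
  unfolding links_def by blast

lemma links_union_blocks:
  "links (insert (A \<union> B) (a - {A, B})) = links a \<union> (A \<union> B) \<times> (A \<union> B)"
  if "A \<in> a" "B \<in> a"
proof -
  have "links a = links (insert A (insert B (a - {A, B})))"
    using that by (intro arg_cong[of _ _ links]) blast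
  thus ?thesis unfolding links_insert by blast
qed

lemma links_merge:
  assumes a: "partition_on V a" and xy: "x \<in> V" "y \<in> V"
  shows "links (merge_blocks a x y) = links a \<union> links a `` {x, y} \<times> links a `` {x, y}"
proof -
  have "links a `` {x, y} = links a `` {x} \<union> links a `` {y}" by blast
  thus ?thesis
    using links_union_blocks[OF class_mem[OF a xy(1)] class_mem[OF a xy(2)]]
    by (simp only: merge_blocks_def)
qed

text \<open>A pair \<open>d\<close>, \<open>e\<close> from another block cannot separate points of
  the merged block \<open>?W\<close>: not within one of the two old blocks, since \<open>a\<close>
  is noncrossing, and not \<open>x\<close> from \<open>y\<close>, since no vertex lies between
  them.\<close>

lemma merge_noncrossing:
  assumes a: "a \<in> partitions n" "noncrossing a" and xy: "consecutive n x y"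
  shows "noncrossing (merge_blocks a x y)"
proof -
  let ?W = "links a `` {x, y}"
  let ?o = vertex_order
  note p = partitionsD[OF a(1)]
  have xyV: "x \<in> verts n" "y \<in> verts n" using xy by (auto simp: consecutive_def)
  have sym: "(s, t) \<in> links a \<Longrightarrow> (t, s) \<in> links a" for s t by (auto simp: links_def)
  have trans: "(s, t) \<in> links a \<Longrightarrow> (t, u) \<in> links a \<Longrightarrow> (s, u) \<in> links a" for s t u
    using p(2) by (meson equivE transD)
  have self: "x \<in> ?W" "y \<in> ?W" using p(2) xyV by (auto dest: equiv_class_self)
  have nc: "(s, u) \<in> links a" if "?o s < ?o u" "?o u < ?o t" "?o t < ?o v" "(s, t) \<in> links a" "(u, v) \<in> links a"
    for s t u v using a(2) that unfolding noncrossing_def by blast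
  have key: "?o d < ?o w \<and> ?o w < ?o e \<longleftrightarrow> ?o d < ?o w' \<and> ?o w' < ?o e"
    if de: "(d, e) \<in> links a" "d \<notin> ?W" and w: "w \<in> ?W" "w' \<in> ?W" for d e w w'
  proof -
    have e: "e \<notin> ?W" using de sym trans by blast
    have deV: "d \<in> verts n" "e \<in> verts n" using de p(3) by auto
    have ne: "?o z \<noteq> ?o d \<and> ?o z \<noteq> ?o e" if z: "z \<in> ?W" for z
    proof -
      have "z \<in> verts n" using z p(3) by blast
      thus ?thesis
        using inj_on_eq_iff[OF inj_on_vertex_order, of z n d] inj_on_eq_iff[OF inj_on_vertex_order, of z n e]
          deV de(2) e z by blast
    qed
    \<comment> \<open>Inside a single old block: a point \<open>t\<close> beyond \<open>d\<close> or
      \<open>e\<close> would make the pair \<open>s\<close>, \<open>t\<close> interleave with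
      \<open>d\<close>, \<open>e\<close>, and their blocks would coincide.\<close>
    have one: "?o d < ?o t \<and> ?o t < ?o e" if st: "(s, t) \<in> links a" "s \<in> ?W" "t \<in> ?W" "?o d < ?o s" "?o s < ?o e" for s t
    proof (rule ccontr)
      assume "\<not> ?thesis"
      hence "?o t < ?o d \<or> ?o e < ?o t" using ne[OF st(3)] by linarith
      thus False
      proof
        assume "?o t < ?o d"
        hence "(t, d) \<in> links a" using nc[of t d s e] st de sym by blast
        thus False using st(3) de(2) trans by blast
      next
        assume "?o e < ?o t"
        hence "(d, s) \<in> links a" using nc[of d s e t] st de by blast
        thus False using st(2) de(2) trans sym by blast
      qed
    qed
    have xy_iff: "?o d < ?o x \<and> ?o x < ?o e \<longleftrightarrow> ?o d < ?o y \<and> ?o y < ?o e"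
      using xy deV ne[OF self(1)] ne[OF self(2)] unfolding consecutive_def by force
    have "?o d < ?o w \<and> ?o w < ?o e \<longleftrightarrow> ?o d < ?o x \<and> ?o x < ?o e" if w: "w \<in> ?W" for w
    proof -
      obtain z where z: "z = x \<or> z = y" "(w, z) \<in> links a" "(z, w) \<in> links a" "z \<in> ?W" using w sym self by blast
      have "?o d < ?o w \<and> ?o w < ?o e \<longleftrightarrow> ?o d < ?o z \<and> ?o z < ?o e"
        using one[OF z(2) w z(4)] one[OF z(3) z(4) w] by blast
      thus ?thesis using z(1) xy_iff by blast
    qed
    thus ?thesis using w by blast
  qed
  show ?thesis
    unfolding noncrossing_def links_merge[OF p(1) xyV]
  proof (intro allI impI)
    fix s t u v
    assume o: "?o s < ?o t" "?o t < ?o u" "?o u < ?o v"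
      and su: "(s, u) \<in> links a \<union> ?W \<times> ?W" and tv: "(t, v) \<in> links a \<union> ?W \<times> ?W"
    have mem: "(d, e) \<in> ?W \<times> ?W \<or> (d, e) \<in> links a \<and> d \<notin> ?W" if "(d, e) \<in> links a \<union> ?W \<times> ?W" for d e
      using that trans by blast
    consider "(s, u) \<in> ?W \<times> ?W" "(t, v) \<in> ?W \<times> ?W" | "(s, u) \<in> ?W \<times> ?W" "(t, v) \<in> links a" "t \<notin> ?W"
      | "(t, v) \<in> ?W \<times> ?W" "(s, u) \<in> links a" "s \<notin> ?W" | "(s, u) \<in> links a" "(t, v) \<in> links a"
      using mem[OF su] mem[OF tv] by blast
    thus "(s, t) \<in> links a \<union> ?W \<times> ?W"
    proof cases
      case 2
      hence "?o t < ?o s" using key[of t v u s] o by blast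
      thus ?thesis using o by simp
    next
      case 3
      hence "?o v < ?o u" using key[of s u t v] o by blast
      thus ?thesis using o by simp
    next
      case 4
      thus ?thesis using nc o by blast
    qed blast
  qed
qed

text \<open>The clique on the merged block is generated by the old links and the single edge from
  \<open>x\<close> to \<open>y\<close>, so merging amounts to inserting one edge into the product
  graph.\<close>

lemma product_rel_merge:
  assumes a: "a \<in> partitions n" and xy: "x \<in> verts n" "y \<in> verts n"
  shows "(product_rel (merge_blocks a x y) b)\<^sup>* =
    (product_rel a b \<union> {(lower_to_middle x, lower_to_middle y), (lower_to_middle y, lower_to_middle x)})\<^sup>*"
    (is "_ = ?T\<^sup>*")
proof (rule rtrancl_eqI)
  let ?W = "links a `` {x, y}" and ?f = lower_to_middle
  note p = partitionsD[OF a]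
  have self: "x \<in> ?W" "y \<in> ?W" using p(2) xy by (auto dest: equiv_class_self)
  have prod: "product_rel (merge_blocks a x y) b = product_rel a b \<union> map_prod ?f ?f ` (?W \<times> ?W)"
    unfolding product_rel_def links_merge[OF p(1) xy] image_Un by blast
  have sym: "sym ?T" using sym_product_rel by (auto simp: sym_def)
  have W: "(?f x, ?f w) \<in> ?T\<^sup>*" if w: "w \<in> ?W" for w
  proof -
    obtain z where z: "z = x \<or> z = y" "(z, w) \<in> links a" using w by blast
    have "(?f z, ?f w) \<in> ?T" using z(2) by (auto simp: product_rel_def)
    moreover have "(?f x, ?f z) \<in> ?T\<^sup>*" using z(1) by auto
    ultimately show ?thesis by (rule rtrancl_into_rtrancl[rotated])
  qed
  have "map_prod ?f ?f ` (?W \<times> ?W) \<subseteq> ?T\<^sup>*"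
  proof (rule image_subsetI)
    fix z assume "z \<in> ?W \<times> ?W"
    then obtain s t where st: "z = (s, t)" "s \<in> ?W" "t \<in> ?W" by (rule SigmaE) auto
    have "(?f s, ?f x) \<in> ?T\<^sup>*" using W[OF st(2)] sym_rtrancl[OF sym] by (rule symD[rotated])
    thus "map_prod ?f ?f z \<in> ?T\<^sup>*" using W[OF st(3)] st(1) by simp
  qed
  thus "product_rel (merge_blocks a x y) b \<subseteq> ?T\<^sup>*" unfolding prod by blast
  have "(?f s, ?f t) \<in> map_prod ?f ?f ` (?W \<times> ?W)" if "s \<in> ?W" "t \<in> ?W" for s t
    using that by (intro image_eqI[of _ _ "(s, t)"]) auto
  hence "(?f x, ?f y) \<in> product_rel (merge_blocks a x y) b" "(?f y, ?f x) \<in> product_rel (merge_blocks a x y) b"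
    unfolding prod using self by blast+
  moreover have "product_rel a b \<subseteq> product_rel (merge_blocks a x y) b" unfolding prod by blast
  ultimately have "?T \<subseteq> product_rel (merge_blocks a x y) b" by simp
  thus "?T \<subseteq> (product_rel (merge_blocks a x y) b)\<^sup>*" by (rule order_trans) (rule r_into_rtrancl[THEN subrelI])
qed

section \<open>Re-pairing two blocks of a perfect matching\<close>

definition switch :: "'a set set \<Rightarrow> 'a \<Rightarrow> 'a \<Rightarrow> 'a \<Rightarrow> 'a \<Rightarrow> 'a set set" where
  "switch a x u y v = insert {x, y} (insert {u, v} (a - {{x, u}, {y, v}}))"

lemma switch_partition:
  assumes a: "partition_on V a" and xu: "{x, u} \<in> a" and yv: "{y, v} \<in> a" and ne: "{x, u} \<noteq> {y, v}"
    and two: "u \<noteq> x" "v \<noteq> y"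
  shows "partition_on V (switch a x u y v)"
proof -
  have U: "\<Union>a = V" and disj: "\<And>C D. C \<in> a \<Longrightarrow> D \<in> a \<Longrightarrow> C \<noteq> D \<Longrightarrow> C \<inter> D = {}" and ne0: "{} \<notin> a"
    using a by (auto simp: partition_on_def disjoint_def)
  have off: "x \<notin> D" "u \<notin> D" "y \<notin> D" "v \<notin> D" if "D \<in> a - {{x, u}, {y, v}}" for D
    using that disj[OF xu, of D] disj[OF yv, of D] by blast+
  have d: "x \<noteq> y" "x \<noteq> v" "u \<noteq> y" "u \<noteq> v" using disj[OF xu yv ne] by auto
  show ?thesis
  proof (rule partition_onI)
    show "\<Union> (switch a x u y v) = V" using U xu yv unfolding switch_def by blast
    show "{} \<notin> switch a x u y v" using ne0 unfolding switch_def by blast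
    let ?S = "{{x, y}, {u, v}}" and ?R = "a - {{x, u}, {y, v}}"
    have "disjnt {x, y} {u, v}" using d two by simp
    hence SS: "disjnt C D" if "C \<in> ?S" "D \<in> ?S" "C \<noteq> D" for C D
      using that by (metis disjnt_sym empty_iff insert_iff)
    have SR: "disjnt C D" if "C \<in> ?S" "D \<in> ?R" for C D
    proof -
      have "C = {x, y} \<or> C = {u, v}" using that(1) by simp
      thus ?thesis by (elim disjE) (simp_all add: off[OF that(2)])
    qed
    have RR: "disjnt C D" if "C \<in> ?R" "D \<in> ?R" "C \<noteq> D" for C D
      using disj[of C D] that by (simp add: disjnt_def)
    have mem: "C \<in> ?S \<or> C \<in> ?R" if "C \<in> switch a x u y v" for C
      using that by (simp only: switch_def insert_iff empty_iff simp_thms disj_assoc)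
    show "disjnt p q" if pq: "p \<in> switch a x u y v" "q \<in> switch a x u y v" "p \<noteq> q" for p q
      using mem[OF pq(1)] mem[OF pq(2)] pq(3) SS RR SR[of p q] disjnt_sym[OF SR[of q p]] by (elim disjE)
  qed
qed

text \<open>The result refines the merged partition, which is noncrossing, so a crossing could only
  occur between \<open>{x, y}\<close> and \<open>{u, v}\<close>. But no vertex lies between the
  neighbours \<open>x\<close> and \<open>y\<close>, so nothing interleaves with
  \<open>{x, y}\<close>.\<close>

lemma switch_noncrossing:
  assumes a: "a \<in> partitions n" "noncrossing a" and xy: "consecutive n x y"
    and xu: "{x, u} \<in> a" and yv: "{y, v} \<in> a"
  shows "noncrossing (switch a x u y v)"
proof -
  let ?o = vertex_order
  note p = partitionsD[OF a(1)]
  have xyV: "x \<in> verts n" "y \<in> verts n" and lt: "?o x < ?o y"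
    and none: "\<And>w. w \<in> verts n \<Longrightarrow> \<not> (?o x < ?o w \<and> ?o w < ?o y)"
    using xy by (auto simp: consecutive_def)
  let ?W = "{x, u} \<union> {y, v}"
  let ?a = "a - {{x, u}, {y, v}}"
  have "links a `` {x} = {x, u}" "links a `` {y} = {y, v}"
    using links_class[OF p(1) xu] links_class[OF p(1) yv] by simp_all
  hence W: "links a `` {x, y} = ?W" by blast
  note m = links_merge[OF p(1) xyV, unfolded W]
  have ncm: "noncrossing (merge_blocks a x y)" by (rule merge_noncrossing[OF a xy])
  have L: "links (switch a x u y v) = links ?a \<union> {x, y} \<times> {x, y} \<union> {u, v} \<times> {u, v}"
    unfolding switch_def links_insert by blast
  have disj: "\<And>C D. C \<in> a \<Longrightarrow> D \<in> a \<Longrightarrow> C \<noteq> D \<Longrightarrow> C \<inter> D = {}"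
    using p(1) by (auto simp: partition_on_def disjoint_def)
  have off: "(s, t) \<in> links ?a \<longleftrightarrow> (s, t) \<in> links a \<and> s \<notin> ?W" for s t
  proof
    assume "(s, t) \<in> links ?a"
    then obtain D where D: "D \<in> ?a" "s \<in> D" "t \<in> D" unfolding links_def by blast
    hence "s \<notin> ?W" using disj[OF xu, of D] disj[OF yv, of D] by blast
    thus "(s, t) \<in> links a \<and> s \<notin> ?W" using D unfolding links_def by blast
  next
    assume "(s, t) \<in> links a \<and> s \<notin> ?W"
    thus "(s, t) \<in> links ?a" unfolding links_def by blast
  qed
  have WV: "?W \<subseteq> verts n" using W p(3) by blast
  have sub: "links (switch a x u y v) \<subseteq> links (merge_blocks a x y)"
    unfolding L m using off by fast
  have verts_sw: "s \<in> verts n \<and> t \<in> verts n" if "(s, t) \<in> links (switch a x u y v)" for s t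
  proof -
    have "(s, t) \<in> links a \<union> ?W \<times> ?W" using sub m that by blast
    thus ?thesis using WV p(3) by blast
  qed
  show ?thesis
    unfolding noncrossing_def
  proof (intro allI impI)
    fix s t r w
    assume o: "?o s < ?o t" "?o t < ?o r" "?o r < ?o w"
      and sr: "(s, r) \<in> links (switch a x u y v)" and tw: "(t, w) \<in> links (switch a x u y v)"
    have "(s, t) \<in> links (merge_blocks a x y)"
      using ncm o sr tw sub unfolding noncrossing_def by blast
    hence st: "(s, t) \<in> links a \<union> ?W \<times> ?W" unfolding m .
    have not_xy: "\<not> (c \<in> {x, y} \<and> e \<in> {x, y})" if "?o c < ?o d" "?o d < ?o e" "d \<in> verts n" for c d e
      using that none[of d] lt by auto
    have A: "(s, r) \<notin> {x, y} \<times> {x, y}" using not_xy[of s t r] o verts_sw[OF tw] by blast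
    have B: "(t, w) \<notin> {x, y} \<times> {x, y}" using not_xy[of t r w] o verts_sw[OF sr] by blast
    consider "(s, r) \<in> {u, v} \<times> {u, v}" "(t, w) \<in> {u, v} \<times> {u, v}" | "(s, r) \<in> links ?a" | "(t, w) \<in> links ?a"
      using sr tw A B unfolding L by blast
    thus "(s, t) \<in> links (switch a x u y v)"
    proof cases
      case 1
      thus ?thesis unfolding L by blast
    next
      case 2
      hence "s \<notin> ?W" using off by blast
      hence "(s, t) \<in> links ?a" using st off by blast
      thus ?thesis unfolding L by blast
    next
      case 3
      hence t: "t \<notin> ?W" using off by blast
      hence "(s, t) \<in> links a" using st by blast
      hence "(t, s) \<in> links a" unfolding links_def by blast
      hence "(t, s) \<in> links ?a" using t off by blast
      hence "(s, t) \<in> links ?a" unfolding links_def by blast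
      thus ?thesis unfolding L by blast
    qed
  qed
qed

text \<open>A set closed under the blocks is a disjoint union of pairs.\<close>

lemma even_card_matching:
  assumes p: "partition_on V a" and two: "\<And>B. B \<in> a \<Longrightarrow> card B = 2"
    and D: "D \<subseteq> V" "finite D" "\<And>B. B \<in> a \<Longrightarrow> B \<inter> D \<noteq> {} \<Longrightarrow> B \<subseteq> D"
  shows "even (card D)"
proof -
  let ?P = "{B \<in> a. B \<subseteq> D}"
  have "D = \<Union>?P"
  proof
    show "D \<subseteq> \<Union>?P"
    proof
      fix z assume z: "z \<in> D"
      then obtain B where "B \<in> a" "z \<in> B" using D(1) p by (auto simp: partition_on_def)
      thus "z \<in> \<Union>?P" using D(3)[of B] z by blast
    qed
  qed blast
  moreover have "card (\<Union>?P) = sum card ?P"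
  proof (rule card_Union_disjoint)
    show "pairwise disjnt ?P"
      using p unfolding partition_on_def disjoint_def pairwise_def disjnt_def by blast
    show "\<And>B. B \<in> ?P \<Longrightarrow> finite B" using D(2) finite_subset by blast
  qed
  moreover have "sum card ?P = 2 * card ?P" using two by simp
  ultimately show ?thesis by simp
qed

lemma card_2_block:
  assumes "partition_on V a" "\<And>B. B \<in> a \<Longrightarrow> card B = 2" "x \<in> V"
  obtains u where "{x, u} \<in> a" "u \<noteq> x"
proof -
  obtain B where B: "B \<in> a" "x \<in> B" using assms(1,3) by (auto simp: partition_on_def)
  then obtain s t where "B = {s, t}" "s \<noteq> t" using assms(2) by (meson card_2_iff)
  thus ?thesis using that[of s] that[of t] B by (auto simp: insert_commute)
qed

lemma card_preimage:
  assumes "inj_on g V" "D \<subseteq> g ` V"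
  shows "card {w \<in> V. g w \<in> D} = card D"
proof -
  have "g ` {w \<in> V. g w \<in> D} = D" using assms(2) by blast
  moreover have "inj_on g {w \<in> V. g w \<in> D}" using assms(1) by (rule inj_on_subset) blast
  ultimately show ?thesis using card_image by fastforce
qed

text \<open>
  If \<open>y\<close> and \<open>v\<close> were separated, the remaining component of \<open>y\<close> would be matched perfectly by the
  pairs of \<open>b\<close>, and by those of \<open>a\<close> after removal of \<open>y\<close>: its size would be both even and odd.
\<close>

lemma reconnect_matching:
  assumes ab: "a \<in> brauer n" "b \<in> brauer n"
    and xu: "{x, u} \<in> a" and yv: "{y, v} \<in> a"
    and y: "(product_rel a b)\<^sup>* `` {lower_to_middle y} \<subseteq> Middle ` {1..n}"
    and xy: "(lower_to_middle y, lower_to_middle x) \<notin> (product_rel a b)\<^sup>*"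
  shows "(lower_to_middle y, lower_to_middle v) \<in> (product_rel (a - {{x, u}, {y, v}}) b)\<^sup>*"
proof (rule ccontr)
  let ?f = lower_to_middle and ?g = upper_to_middle
  let ?a = "a - {{x, u}, {y, v}}"
  let ?G = "product_rel a b" and ?H = "product_rel ?a b"
  let ?D = "?H\<^sup>* `` {?f y}"
  assume v: "(?f y, ?f v) \<notin> ?H\<^sup>*"
  have pa: "partition_on (verts n) a" "\<And>B. B \<in> a \<Longrightarrow> card B = 2"
    and pb: "partition_on (verts n) b" "\<And>B. B \<in> b \<Longrightarrow> card B = 2"
    using ab by (auto simp: brauer_def partitions_def)
  have HG: "?H \<subseteq> ?G" unfolding product_rel_def links_def by blast
  have HGs: "?H\<^sup>* \<subseteq> ?G\<^sup>*" using HG by (rule rtrancl_mono)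
  have DM: "?D \<subseteq> Middle ` {1..n}" using HGs y by blast
  have stepH: "(?f y, t) \<in> ?H\<^sup>*" if "(?f y, s) \<in> ?H\<^sup>*" "(s, t) \<in> ?H" for s t
    using that by (rule rtrancl_into_rtrancl)
  have finD: "finite ?D" using DM finite_subset by blast
  have yD: "?f y \<in> ?D" by simp
  have y_V: "y \<in> verts n" "v \<in> verts n" using yv pa(1) by (auto simp: partition_on_def)
  have inj_f: "inj_on ?f (verts n)" and inj_g: "inj_on ?g (verts n)"
    by (auto simp: inj_on_def verts_def)
  have "Middle ` {1..n} \<subseteq> ?f ` verts n" "Middle ` {1..n} \<subseteq> ?g ` verts n"
    unfolding verts_def image_Un image_image by simp_all
  hence surj: "?D \<subseteq> ?f ` verts n" "?D \<subseteq> ?g ` verts n" using DM by (meson subset_trans)+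
  \<comment> \<open>Removing the pair \<open>{x, u}\<close> does not affect the component of
    \<open>y\<close>, because neither \<open>x\<close> nor \<open>u\<close> is in it.\<close>
  have x_out: "?f x \<notin> ?D" "?f u \<notin> ?D"
  proof -
    show "?f x \<notin> ?D" using HGs xy by blast
    have "(u, x) \<in> links a" using xu by (auto simp: links_def)
    hence "(?f u, ?f x) \<in> ?G" by (auto simp: product_rel_def)
    thus "?f u \<notin> ?D" using HGs xy by (meson Image_singleton_iff rtrancl_into_rtrancl subsetD)
  qed
  \<comment> \<open>As \<open>?D\<close> lies in the middle row, \<open>?B\<close> consists of upper
    vertices of \<open>b\<close> and \<open>?A\<close> of lower vertices of \<open>a\<close>. The
    pair of \<open>y\<close> has been removed, so \<open>y\<close> is left out of
    \<open>?A\<close>.\<close>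
  let ?B = "{w \<in> verts n. ?g w \<in> ?D}" and ?A = "{w \<in> verts n. ?f w \<in> ?D - {?f y}}"
  have cB: "card ?B = card ?D" by (rule card_preimage[OF inj_g surj(2)])
  have cA: "card ?A = card (?D - {?f y})"
    by (rule card_preimage[OF inj_f subset_trans[OF Diff_subset surj(1)]])
  have fin: "finite (verts n)" by (simp add: verts_def)
  have "even (card ?B)"
  proof (rule even_card_matching[OF pb])
    fix B assume B: "B \<in> b" "B \<inter> ?B \<noteq> {}"
    then obtain w where w: "w \<in> B" "?g w \<in> ?D" by blast
    show "B \<subseteq> ?B"
    proof
      fix t assume t: "t \<in> B"
      have "(w, t) \<in> links b" using w(1) t B(1) by (intro linksI)
      hence "(?g w, ?g t) \<in> ?H" by (auto simp: product_rel_def)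
      hence "?g t \<in> ?D" using w(2) stepH by blast
      moreover have "t \<in> verts n" using t B(1) pb(1) by (auto simp: partition_on_def)
      ultimately show "t \<in> ?B" by blast
    qed
  qed (use fin in auto)
  moreover have "even (card ?A)"
  proof (rule even_card_matching[OF pa])
    fix B assume B: "B \<in> a" "B \<inter> ?A \<noteq> {}"
    then obtain w where w: "w \<in> B" "w \<in> verts n" "?f w \<in> ?D" "?f w \<noteq> ?f y" by blast
    have Bxu: "B \<noteq> {x, u}" using w x_out by blast
    \<comment> \<open>\<open>v\<close> is excluded by the assumption that it has been separated from
      \<open>y\<close>. So the block of \<open>w\<close> is not one of the removed pairs.\<close>
    have "w \<noteq> y" "w \<noteq> v" using w v by auto
    hence Byv: "B \<noteq> {y, v}" using w(1) by blast
    show "B \<subseteq> ?A"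
    proof
      fix t assume t: "t \<in> B"
      have "(w, t) \<in> links ?a" using w(1) t B(1) Bxu Byv by (intro linksI[of B]) auto
      hence "(?f w, ?f t) \<in> ?H" by (auto simp: product_rel_def)
      hence "?f t \<in> ?D" using w(3) stepH by blast
      moreover have tV: "t \<in> verts n" using t B(1) pa(1) by (auto simp: partition_on_def)
      moreover have "?f t \<noteq> ?f y"
      proof
        assume "?f t = ?f y"
        hence "t = y" using inj_f tV y_V(1) by (meson inj_onD)
        hence "B = {y, v}" using links_class[OF pa(1) B(1) t] links_class[OF pa(1) yv, of y] by simp
        thus False using Byv by simp
      qed
      ultimately show "t \<in> ?A" by blast
    qed
  qed (use fin in auto)
  moreover have "card ?D = Suc (card (?D - {?f y}))" using finD yD by (rule card.remove)
  ultimately show False using cA cB by simp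
qed

text \<open>Each lost or new edge is replaced by a walk:
  \<open>u\<close>-\<open>x\<close>-\<open>y\<close>-\<open>v\<close> gives the new pair
  \<open>{u, v}\<close>, the rest of the cycle through \<open>y\<close> gives the lost pair
  \<open>{y, v}\<close> by \<open>reconnect_matching\<close>, and
  \<open>x\<close>-\<open>y\<close>-...-\<open>v\<close>-\<open>u\<close> gives the lost pair
  \<open>{x, u}\<close>.\<close>

lemma product_rel_switch:
  assumes ab: "a \<in> brauer n" "b \<in> brauer n"
    and xu: "{x, u} \<in> a" and yv: "{y, v} \<in> a"
    and y: "(product_rel a b)\<^sup>* `` {lower_to_middle y} \<subseteq> Middle ` {1..n}"
    and xy: "(lower_to_middle y, lower_to_middle x) \<notin> (product_rel a b)\<^sup>*"
  shows "(product_rel (switch a x u y v) b)\<^sup>* =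
    (product_rel a b \<union> {(lower_to_middle x, lower_to_middle y), (lower_to_middle y, lower_to_middle x)})\<^sup>*"
    (is "?S\<^sup>* = ?T\<^sup>*")
proof (rule rtrancl_eqI)
  let ?f = lower_to_middle
  let ?a = "a - {{x, u}, {y, v}}"
  have mp: "map_prod ?f ?f ` ({s, t} \<times> {s, t}) = {?f s, ?f t} \<times> {?f s, ?f t}" for s t
    unfolding map_prod_surj_on[OF refl refl] by simp
  have S: "?S = product_rel ?a b \<union> {?f x, ?f y} \<times> {?f x, ?f y} \<union> {?f u, ?f v} \<times> {?f u, ?f v}"
    unfolding product_rel_def switch_def links_insert image_Un mp by blast
  have "a = insert {x, u} (insert {y, v} ?a)" using xu yv by blast
  hence La: "links a = links ?a \<union> {y, v} \<times> {y, v} \<union> {x, u} \<times> {x, u}" by (metis links_insert)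
  have G: "product_rel a b = product_rel ?a b \<union> {?f y, ?f v} \<times> {?f y, ?f v} \<union> {?f x, ?f u} \<times> {?f x, ?f u}"
    unfolding product_rel_def[of a] La image_Un mp unfolding product_rel_def by blast
  have symT: "sym ?T" using sym_product_rel[of a b] unfolding sym_def by blast
  have symS: "sym ?S" by (rule sym_product_rel)
  have T: "(?f u, ?f v) \<in> ?T\<^sup>*"
  proof -
    have "(?f u, ?f x) \<in> ?T" "(?f x, ?f y) \<in> ?T" "(?f y, ?f v) \<in> ?T" unfolding G by blast+
    thus ?thesis by (meson r_into_rtrancl rtrancl_into_rtrancl)
  qed
  have "(?f v, ?f u) \<in> ?T\<^sup>*" using T sym_rtrancl[OF symT] by (meson symD)
  moreover have "product_rel ?a b \<union> {?f x, ?f y} \<times> {?f x, ?f y} \<subseteq> ?T\<^sup>*" unfolding G by auto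
  ultimately show "?S \<subseteq> ?T\<^sup>*" using T unfolding S by auto
  have yv': "(?f y, ?f v) \<in> ?S\<^sup>*"
    using reconnect_matching[OF ab xu yv y xy] rtrancl_mono[of "product_rel ?a b" ?S] unfolding S by blast
  moreover have "(?f x, ?f u) \<in> ?S\<^sup>*"
  proof -
    have "(?f x, ?f y) \<in> ?S" "(?f v, ?f u) \<in> ?S" unfolding S by blast+
    thus ?thesis using yv' by (meson converse_rtrancl_into_rtrancl rtrancl_into_rtrancl)
  qed
  moreover have "(?f v, ?f y) \<in> ?S\<^sup>*" "(?f u, ?f x) \<in> ?S\<^sup>*" 
    using calculation sym_rtrancl[OF symS] by (meson symD)+
  moreover have "product_rel ?a b \<subseteq> ?S\<^sup>*" "(?f x, ?f y) \<in> ?S\<^sup>*" "(?f y, ?f x) \<in> ?S\<^sup>*" unfolding S by auto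
  ultimately show "?T \<subseteq> ?S\<^sup>*" unfolding G by auto
qed

section \<open>Tightness\<close>

lemma partitions_eqI:
  assumes "a \<in> partitions n" "b \<in> partitions n" "links a = links b"
  shows "a = b"
proof -
  have "c = verts n // links c" if "c \<in> partitions n" for c
    using partition_on_eq_quotient[OF partitionsD(1)[OF that]] by (simp add: links_def)
  thus ?thesis using assms by metis
qed

lemma verts_simps [simp]:
  "Upper i \<in> verts n \<longleftrightarrow> 1 \<le> i \<and> i \<le> n"
  "Lower i \<in> verts n \<longleftrightarrow> 1 \<le> i \<and> i \<le> n"
  "Middle i \<notin> verts n"
  by (auto simp: verts_def)

text \<open>Hypothesis \<open>step\<close> abstracts from merging and switching: inside
  \<open>S\<close>, an edge can be inserted between a floating component and its left neighbour.
  Each insertion preserves the product and removes one floating component, whence the induction on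
  their number.\<close>

lemma left_tight:
  assumes S: "S \<subseteq> partitions n"
    and step: "\<And>a b x y. a \<in> S \<Longrightarrow> b \<in> S \<Longrightarrow> consecutive n x y \<Longrightarrow>
      (product_rel a b)\<^sup>* `` {lower_to_middle y} \<subseteq> Middle ` {1..n} \<Longrightarrow>
      (lower_to_middle y, lower_to_middle x) \<notin> (product_rel a b)\<^sup>* \<Longrightarrow>
      \<exists>a'\<in>S. (product_rel a' b)\<^sup>* = (product_rel a b \<union>
        {(lower_to_middle x, lower_to_middle y), (lower_to_middle y, lower_to_middle x)})\<^sup>*"
    and a: "a \<in> S" and b: "b \<in> S"
  shows "\<exists>a'\<in>S. pmult n a b = pmult n a' b \<and> canonical_twisting n a' b = 0"
  using a
proof (induction "canonical_twisting n a b" arbitrary: a)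
  case 0
  thus ?case by auto
next
  case (Suc k)
  let ?R = "product_rel a b" and ?M = "Middle ` {1..n}"
  have ab: "a \<in> partitions n" "b \<in> partitions n" using Suc.prems b S by auto
  have symR: "sym ?R" by (rule sym_product_rel)
  have "floating ?M ?R \<noteq> {}" using Suc.hyps(2) unfolding canonical_twisting_eq[OF ab] by auto
  then obtain C where "C \<in> floating ?M ?R" by blast
  then obtain m where m: "C = ?R\<^sup>* `` {m}" "C \<subseteq> ?M" by (rule floatingE)
  hence "m \<in> ?M" by blast
  then obtain i0 where "?R\<^sup>* `` {Middle i0} \<subseteq> ?M" "1 \<le> i0" "i0 \<le> n" using m by auto
  hence ex: "\<exists>i. 1 \<le> i \<and> i \<le> n \<and> ?R\<^sup>* `` {Middle i} \<subseteq> ?M" by blast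
  define i where "i = (LEAST i. 1 \<le> i \<and> i \<le> n \<and> ?R\<^sup>* `` {Middle i} \<subseteq> ?M)"
  have i: "1 \<le> i" "i \<le> n" "?R\<^sup>* `` {Middle i} \<subseteq> ?M"
    using LeastI_ex[OF ex] unfolding i_def by auto
  have least: "\<not> (1 \<le> j \<and> j \<le> n \<and> ?R\<^sup>* `` {Middle j} \<subseteq> ?M)" if "j < i" for j
    using not_less_Least[OF that[unfolded i_def]] .
  \<comment> \<open>For \<open>i = 1\<close> the neighbour \<open>Upper 1\<close> is outside the
    middle row, so it is not in the floating component. Otherwise the minimality of \<open>i\<close>
    keeps \<open>i - 1\<close> out of it.\<close>
  define x where "x = (if i = 1 then Upper 1 else Lower (i - 1))"
  have cons: "consecutive n x (Lower i)"
  proof -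
    have "x \<in> verts n" using i(1,2) by (auto simp: x_def)
    moreover have "\<not> (vertex_order x < vertex_order w \<and> vertex_order w < int i)" if "w \<in> verts n" for w
      using that i(1) by (cases w) (auto simp: x_def)
    ultimately show ?thesis using i(1,2) by (auto simp: consecutive_def x_def)
  qed
  have x: "(lower_to_middle (Lower i), lower_to_middle x) \<notin> ?R\<^sup>*"
  proof (cases "i = 1")
    case True
    thus ?thesis using i(3) by (auto simp: x_def)
  next
    case False
    show ?thesis
    proof
      assume "(lower_to_middle (Lower i), lower_to_middle x) \<in> ?R\<^sup>*"
      hence "(Middle i, Middle (i - 1)) \<in> ?R\<^sup>*" using False by (simp add: x_def)
      hence "?R\<^sup>* `` {Middle i} = ?R\<^sup>* `` {Middle (i - 1)}" by (rule class_eqI[OF symR])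
      thus False using least[of "i - 1"] i False by auto
    qed
  qed
  have y: "?R\<^sup>* `` {lower_to_middle (Lower i)} \<subseteq> ?M" using i(3) by simp
  obtain a' where a': "a' \<in> S" "(product_rel a' b)\<^sup>* = (?R \<union>
      {(lower_to_middle x, lower_to_middle (Lower i)), (lower_to_middle (Lower i), lower_to_middle x)})\<^sup>*"
    using step[OF Suc.prems b cons y x] by blast
  have a'b: "a' \<in> partitions n" using a'(1) S by blast
  note edge = card_floating_insert_edge[OF symR finite_imageI[OF finite_atLeastAtMost] y x a'(2)]
  have "canonical_twisting n a b = Suc (canonical_twisting n a' b)"
    unfolding canonical_twisting_eq[OF ab] canonical_twisting_eq[OF a'b ab(2)] by (rule edge(1))
  hence "k = canonical_twisting n a' b" using Suc.hyps(2) by simp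
  then obtain a'' where a'': "a'' \<in> S" "pmult n a' b = pmult n a'' b" "canonical_twisting n a'' b = 0"
    using Suc.hyps(1) a'(1) by blast
  have "v \<notin> ?M" if "v \<in> verts n" for v using that by (auto simp: verts_def)
  hence "{(u, v). u \<in> verts n \<and> v \<in> verts n \<and> (u, v) \<in> ?R\<^sup>*} =
      {(u, v). u \<in> verts n \<and> v \<in> verts n \<and> (u, v) \<in> (product_rel a' b)\<^sup>*}"
    using edge(2) by blast
  hence "pmult n a b = pmult n a' b" unfolding pmult_eq[OF ab] pmult_eq[OF a'b ab(2)] by simp
  thus ?case using a'' by auto
qed

section \<open>Turning the rectangle upside down\<close>

fun flip :: "vertex \<Rightarrow> vertex" where
  "flip (Upper i) = Lower i"
| "flip (Middle i) = Middle i"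
| "flip (Lower i) = Upper i"

abbreviation flip_blocks :: "vertex set set \<Rightarrow> vertex set set" where
  "flip_blocks a \<equiv> (`) flip ` a"

lemma flip_flip [simp]: "flip (flip v) = v"
  by (cases v) auto

lemma inj_flip: "inj flip"
  by (rule injI) (metis flip_flip)

lemma flip_blocks_flip_blocks [simp]: "flip_blocks (flip_blocks a) = a"
  by (simp add: image_image)

lemma flip_verts: "flip ` verts n = verts n"
  by (auto simp: verts_def image_Un image_image)

lemma flip_partitions:
  assumes "a \<in> partitions n"
  shows "flip_blocks a \<in> partitions n"
proof -
  have p: "partition_on (verts n) a" using assms by (simp add: partitions_def)
  have "partition_on (flip ` verts n) (flip_blocks a - {{}})"
    using p inj_on_subset[OF inj_flip] by (intro partition_on_inj_image) auto
  moreover have "flip_blocks a - {{}} = flip_blocks a" using p by (auto simp: partition_on_def)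
  ultimately show ?thesis by (simp add: flip_verts partitions_def)
qed

lemma links_flip: "links (flip_blocks a) = map_prod flip flip ` links a"
proof (intro set_eqI iffI)
  fix z assume "z \<in> links (flip_blocks a)"
  then obtain x y B where "z = (flip x, flip y)" "B \<in> a" "x \<in> B" "y \<in> B" by (auto simp: links_def)
  thus "z \<in> map_prod flip flip ` links a" by (auto simp: links_def)
next
  fix z assume "z \<in> map_prod flip flip ` links a"
  thus "z \<in> links (flip_blocks a)" by (auto simp: links_def)
qed

lemma links_flip_iff: "(x, y) \<in> links (flip_blocks a) \<longleftrightarrow> (flip x, flip y) \<in> links a"
proof
  assume "(x, y) \<in> links (flip_blocks a)"
  thus "(flip x, flip y) \<in> links a" unfolding links_flip by auto
next
  assume "(flip x, flip y) \<in> links a"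
  hence "map_prod flip flip (flip x, flip y) \<in> links (flip_blocks a)" unfolding links_flip by (rule imageI)
  thus "(x, y) \<in> links (flip_blocks a)" by simp
qed

text \<open>Reflection exchanges the two factors, because it exchanges
  \<open>lower_to_middle\<close> and \<open>upper_to_middle\<close>.\<close>

lemma product_rel_flip:
  "product_rel (flip_blocks b) (flip_blocks a) = map_prod flip flip ` product_rel a b"
proof -
  have "lower_to_middle (flip v) = flip (upper_to_middle v)"
    "upper_to_middle (flip v) = flip (lower_to_middle v)" for v by (cases v; simp)+
  thus ?thesis
    by (simp add: product_rel_def links_flip image_Un image_image map_prod_def split_def Un_commute)
qed

lemma canonical_twisting_flip:
  assumes "a \<in> partitions n" "b \<in> partitions n"
  shows "canonical_twisting n (flip_blocks b) (flip_blocks a) = canonical_twisting n a b"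
proof -
  have "flip ` Middle ` {1..n} = Middle ` {1..n}" by (simp add: image_image)
  thus ?thesis
    using card_floating_map[OF inj_flip, of "Middle ` {1..n}" "product_rel a b"]
    by (simp add: canonical_twisting_eq assms flip_partitions product_rel_flip)
qed

lemma pmult_flip:
  assumes "a \<in> partitions n" "b \<in> partitions n"
  shows "pmult n (flip_blocks b) (flip_blocks a) = flip_blocks (pmult n a b)"
proof (rule partitions_eqI)
  note fab = flip_partitions[OF assms(2)] flip_partitions[OF assms(1)]
  show "pmult n (flip_blocks b) (flip_blocks a) \<in> partitions n" by (rule pmult_partitions[OF fab])
  show "flip_blocks (pmult n a b) \<in> partitions n" by (intro flip_partitions pmult_partitions assms)
  have V: "flip v \<in> verts n \<longleftrightarrow> v \<in> verts n" for v by (cases v) (auto simp: verts_def)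
  have star: "(u, v) \<in> (product_rel (flip_blocks b) (flip_blocks a))\<^sup>* \<longleftrightarrow>
      (flip u, flip v) \<in> (product_rel a b)\<^sup>*" for u v
    using rtrancl_map_prod_iff[OF inj_flip, of "flip u" v "product_rel a b"]
    unfolding product_rel_flip by (metis flip_flip)
  show "links (pmult n (flip_blocks b) (flip_blocks a)) = links (flip_blocks (pmult n a b))"
  proof (rule set_eqI)
    fix z :: "vertex \<times> vertex"
    obtain u v where z: "z = (u, v)" by (cases z)
    show "z \<in> links (pmult n (flip_blocks b) (flip_blocks a)) \<longleftrightarrow> z \<in> links (flip_blocks (pmult n a b))"
      unfolding z links_flip_iff unfolding links_pmult[OF fab] links_pmult[OF assms]
      by (simp add: star V)
  qed
qed

text \<open>Since reflection reverses products and preserves the twisting, the left half of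
  tightness, applied to the reflected factors in reverse order, yields the right half.\<close>

lemma tight_canonicalI:
  assumes S: "S \<subseteq> partitions n" and flip: "\<And>a. a \<in> S \<Longrightarrow> flip_blocks a \<in> S"
    and step: "\<And>a b x y. a \<in> S \<Longrightarrow> b \<in> S \<Longrightarrow> consecutive n x y \<Longrightarrow>
      (product_rel a b)\<^sup>* `` {lower_to_middle y} \<subseteq> Middle ` {1..n} \<Longrightarrow>
      (lower_to_middle y, lower_to_middle x) \<notin> (product_rel a b)\<^sup>* \<Longrightarrow>
      \<exists>a'\<in>S. (product_rel a' b)\<^sup>* = (product_rel a b \<union>
        {(lower_to_middle x, lower_to_middle y), (lower_to_middle y, lower_to_middle x)})\<^sup>*"
  shows "tight S (pmult n) (canonical_twisting n)"
  unfolding tight_def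
proof (intro conjI ballI)
  show "twisting S (pmult n) (canonical_twisting n)"
    using twisting_canonical[of n] S unfolding twisting_def by blast
next
  fix a b assume "a \<in> S" "b \<in> S"
  thus "\<exists>a'\<in>S. pmult n a b = pmult n a' b \<and> canonical_twisting n a' b = 0"
    using left_tight[OF S step] by blast
next
  fix a b assume ab: "a \<in> S" "b \<in> S"
  then obtain c where c: "c \<in> S" "pmult n (flip_blocks b) (flip_blocks a) = pmult n c (flip_blocks a)"
      "canonical_twisting n c (flip_blocks a) = 0"
    using left_tight[OF S step flip flip] by blast
  let ?b' = "flip_blocks c"
  have p: "a \<in> partitions n" "b \<in> partitions n" "?b' \<in> partitions n" using ab c flip S by blast+
  have "flip_blocks (pmult n a b) = flip_blocks (pmult n a ?b')"
    using c(2) by (simp add: pmult_flip[symmetric] p)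
  hence "pmult n a b = pmult n a ?b'" by (metis flip_blocks_flip_blocks)
  moreover have "canonical_twisting n a ?b' = 0"
    using c(3) canonical_twisting_flip[OF p(1,3)] by simp
  ultimately show "\<exists>b'\<in>S. pmult n a b = pmult n a b' \<and> canonical_twisting n a b' = 0"
    using flip[OF c(1)] by blast
qed

text \<open>Reflection negates \<open>vertex_order\<close>, so four interleaved points appear in
  reverse order. The noncrossing property then relates the last two points instead of the first two,
  and transitivity carries this over.\<close>

lemma noncrossing_flip:
  assumes a: "a \<in> partitions n" "noncrossing a"
  shows "noncrossing (flip_blocks a)"
proof -
  have ord: "vertex_order (flip v) = - vertex_order v" for v by (cases v) auto
  have sym: "(y, x) \<in> links a" if "(x, y) \<in> links a" for x y using that by (auto simp: links_def)
  have trans: "(x, z) \<in> links a" if "(x, y) \<in> links a" "(y, z) \<in> links a" for x y z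
    using partitionsD(2)[OF a(1)] that by (meson equivE transD)
  show ?thesis
    unfolding noncrossing_def links_flip_iff
  proof (intro allI impI)
    fix p q r s
    assume o: "vertex_order p < vertex_order q" "vertex_order q < vertex_order r" "vertex_order r < vertex_order s"
      and pr: "(flip p, flip r) \<in> links a" and qs: "(flip q, flip s) \<in> links a"
    have "vertex_order (flip s) < vertex_order (flip r)" "vertex_order (flip r) < vertex_order (flip q)"
      "vertex_order (flip q) < vertex_order (flip p)" using o by (simp_all add: ord)
    hence "(flip s, flip r) \<in> links a"
      using a(2) sym[OF pr] sym[OF qs] unfolding noncrossing_def by blast
    thus "(flip p, flip q) \<in> links a" using trans sym pr qs by blast
  qed
qed

lemma brauer_flip:
  assumes "a \<in> brauer n"
  shows "flip_blocks a \<in> brauer n"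
proof -
  have "card (flip ` B) = card B" for B using inj_on_subset[OF inj_flip] by (intro card_image) auto
  thus ?thesis using assms flip_partitions by (auto simp: brauer_def)
qed

abbreviation noncrossing_partitions :: "nat \<Rightarrow> vertex set set set" where
  "noncrossing_partitions n \<equiv> {a \<in> partitions n. noncrossing a}"

lemma merge_blocks_partitions:
  assumes "a \<in> partitions n" "consecutive n x y"
  shows "merge_blocks a x y \<in> partitions n"
  using assms merge_partition[of "verts n" a x y] by (simp add: partitions_def consecutive_def)

lemma tight_partitions: "tight (partitions n) (pmult n) (canonical_twisting n)"
proof (rule tight_canonicalI)
  fix a b x y assume "a \<in> partitions n" "consecutive n x y"
  thus "\<exists>a'\<in>partitions n. (product_rel a' b)\<^sup>* = (product_rel a b \<union>
      {(lower_to_middle x, lower_to_middle y), (lower_to_middle y, lower_to_middle x)})\<^sup>*"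
    by (intro bexI[of _ "merge_blocks a x y"] product_rel_merge merge_blocks_partitions)
       (auto simp: consecutive_def)
qed (auto intro: flip_partitions)

lemma tight_noncrossing: "tight (noncrossing_partitions n) (pmult n) (canonical_twisting n)"
proof (rule tight_canonicalI)
  fix a b x y assume a: "a \<in> noncrossing_partitions n" and xy: "consecutive n x y"
  hence "merge_blocks a x y \<in> noncrossing_partitions n"
    using merge_blocks_partitions[of a n x y] merge_noncrossing[of a n x y] by simp
  moreover have "(product_rel (merge_blocks a x y) b)\<^sup>* = (product_rel a b \<union>
      {(lower_to_middle x, lower_to_middle y), (lower_to_middle y, lower_to_middle x)})\<^sup>*"
    using a xy by (intro product_rel_merge) (auto simp: consecutive_def)
  ultimately show "\<exists>a'\<in>noncrossing_partitions n. (product_rel a' b)\<^sup>* = (product_rel a b \<union>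
      {(lower_to_middle x, lower_to_middle y), (lower_to_middle y, lower_to_middle x)})\<^sup>*" by blast
qed (auto intro: flip_partitions noncrossing_flip)

text \<open>The implication about \<open>noncrossing\<close> lets one statement serve both the
  Brauer and the Temperley-Lieb monoid.\<close>

lemma switch_exists:
  assumes a: "a \<in> brauer n" and b: "b \<in> brauer n" and xy: "consecutive n x y"
    and y: "(product_rel a b)\<^sup>* `` {lower_to_middle y} \<subseteq> Middle ` {1..n}"
    and yx: "(lower_to_middle y, lower_to_middle x) \<notin> (product_rel a b)\<^sup>*"
  shows "\<exists>a'\<in>brauer n. (noncrossing a \<longrightarrow> noncrossing a') \<and> (product_rel a' b)\<^sup>* = (product_rel a b \<union>
      {(lower_to_middle x, lower_to_middle y), (lower_to_middle y, lower_to_middle x)})\<^sup>*"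
proof -
  have P: "a \<in> partitions n" and pa: "partition_on (verts n) a" "\<And>B. B \<in> a \<Longrightarrow> card B = 2"
    using a by (auto simp: brauer_def partitions_def)
  have V: "x \<in> verts n" "y \<in> verts n" "x \<noteq> y" using xy by (auto simp: consecutive_def)
  obtain u where u: "{x, u} \<in> a" "u \<noteq> x" using card_2_block[OF pa V(1)] .
  obtain v where v: "{y, v} \<in> a" "v \<noteq> y" using card_2_block[OF pa V(2)] .
  \<comment> \<open>If \<open>x\<close> and \<open>y\<close> formed a pair, they would be adjacent
    in the product graph, contrary to \<open>yx\<close>.\<close>
  have ne: "{x, u} \<noteq> {y, v}"
  proof
    assume "{x, u} = {y, v}"
    hence "(y, x) \<in> links a" using linksI[OF u(1), of y x] by blast
    hence "(lower_to_middle y, lower_to_middle x) \<in> product_rel a b" by (auto simp: product_rel_def)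
    thus False using yx by blast
  qed
  have "u \<noteq> v"
  proof
    assume "u = v"
    thus False using ne links_class[OF pa(1) u(1), of u] links_class[OF pa(1) v(1), of v] by simp
  qed
  hence "card B = 2" if "B \<in> switch a x u y v" for B
    using that pa(2) V(3) by (auto simp: switch_def)
  moreover have "switch a x u y v \<in> partitions n"
    using switch_partition[OF pa(1) u(1) v(1) ne u(2) v(2)] by (simp add: partitions_def)
  ultimately have "switch a x u y v \<in> brauer n" by (simp add: brauer_def)
  moreover have "noncrossing a \<longrightarrow> noncrossing (switch a x u y v)"
    using switch_noncrossing[OF P _ xy u(1) v(1)] by blast
  ultimately show ?thesis using product_rel_switch[OF a b u(1) v(1) y yx] by blast
qed

lemma tight_brauer: "tight (brauer n) (pmult n) (canonical_twisting n)"
proof (rule tight_canonicalI)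
  show "brauer n \<subseteq> partitions n" by (auto simp: brauer_def)
next
  fix a b x y
  assume "a \<in> brauer n" "b \<in> brauer n" "consecutive n x y"
    "(product_rel a b)\<^sup>* `` {lower_to_middle y} \<subseteq> Middle ` {1..n}"
    "(lower_to_middle y, lower_to_middle x) \<notin> (product_rel a b)\<^sup>*"
  from switch_exists[OF this]
  show "\<exists>a'\<in>brauer n. (product_rel a' b)\<^sup>* = (product_rel a b \<union>
      {(lower_to_middle x, lower_to_middle y), (lower_to_middle y, lower_to_middle x)})\<^sup>*" by blast
qed (rule brauer_flip)

lemma tight_noncrossing_brauer:
  "tight (brauer n \<inter> noncrossing_partitions n) (pmult n) (canonical_twisting n)"
proof (rule tight_canonicalI)
  fix a b x y
  assume ab: "a \<in> brauer n \<inter> noncrossing_partitions n" "b \<in> brauer n \<inter> noncrossing_partitions n"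
    and xy: "consecutive n x y" 
    and y: "(product_rel a b)\<^sup>* `` {lower_to_middle y} \<subseteq> Middle ` {1..n}"
    and yx: "(lower_to_middle y, lower_to_middle x) \<notin> (product_rel a b)\<^sup>*"
  from ab obtain a' where a': "a' \<in> brauer n" "noncrossing a'" "(product_rel a' b)\<^sup>* = (product_rel a b \<union>
      {(lower_to_middle x, lower_to_middle y), (lower_to_middle y, lower_to_middle x)})\<^sup>*"
    using switch_exists[OF _ _ xy y yx] by blast
  moreover have "a' \<in> partitions n" using a'(1) by (simp add: brauer_def)
  ultimately show "\<exists>a'\<in>brauer n \<inter> noncrossing_partitions n. (product_rel a' b)\<^sup>* = (product_rel a b \<union>
      {(lower_to_middle x, lower_to_middle y), (lower_to_middle y, lower_to_middle x)})\<^sup>*" by blast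
qed (auto intro: flip_partitions noncrossing_flip brauer_flip)

section \<open>Looseness\<close>

definition singletons :: "'a set \<Rightarrow> 'a set set" where
  "singletons V = (\<lambda>v. {v}) ` V"

definition single_pair :: "'a set \<Rightarrow> 'a \<Rightarrow> 'a \<Rightarrow> 'a set set" where
  "single_pair V x y = insert {x, y} (singletons (V - {x, y}))"

lemma links_singletons: "links (singletons V) = Id_on V"
  by (auto simp: links_def singletons_def)

lemma partition_on_singletons: "partition_on V (singletons V)"
  by (rule partition_onI) (auto simp: singletons_def disjnt_def)

lemma partition_on_single_pair:
  assumes "x \<in> V" "y \<in> V"
  shows "partition_on V (single_pair V x y)"
  using assms by (intro partition_onI) (auto simp: single_pair_def singletons_def disjnt_def)

lemma noncrossing_singletons: "noncrossing (singletons V)"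
  by (auto simp: noncrossing_def links_singletons)

lemma noncrossing_single_pair: "noncrossing (single_pair V (Upper 1) (Upper 2))"
  by (auto simp: noncrossing_def single_pair_def links_insert links_singletons)

text \<open>Singletons contribute only loops, so a walk never leaves the block of \<open>a\<close>
  in which it starts.\<close>

lemma rtrancl_product_rel_singletons:
  assumes a: "a \<in> partitions n" and u: "u \<in> verts n"
    and uw: "(lower_to_middle u, w) \<in> (product_rel a (singletons (verts n)))\<^sup>*"
  shows "\<exists>v. (u, v) \<in> links a \<and> w = lower_to_middle v"
  using uw
proof induction
  case base
  have "(u, u) \<in> links a" using partitionsD(2)[OF a] u by (meson equivE refl_onD)
  thus ?case by blast
next
  case (step w w')
  then obtain v where v: "(u, v) \<in> links a" "w = lower_to_middle v" by blast
  have vV: "v \<in> verts n" using v(1) partitionsD(3)[OF a] by blast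
  from step.hyps(2) consider s t where "w = lower_to_middle s" "w' = lower_to_middle t" "(s, t) \<in> links a"
    | "w' = w" by (auto simp: product_rel_def links_singletons)
  thus ?case
  proof cases
    case (1 s t)
    hence "s \<in> verts n" using partitionsD(3)[OF a] by blast
    hence "s = v" using 1 v(2) vV by (auto simp: verts_def)
    hence "(u, t) \<in> links a" using v(1) 1(3) partitionsD(2)[OF a] by (meson equivE transD)
    thus ?thesis using 1 by blast
  next
    case 2
    thus ?thesis using v by blast
  qed
qed

lemma partial_brauer_links:
  assumes "a \<in> partial_brauer n" "(s, t) \<in> links a" "(s, r) \<in> links a"
  shows "s = t \<or> s = r \<or> t = r"
proof (rule ccontr)
  assume ne: "\<not> ?thesis"
  have p: "partition_on (verts n) a" "\<And>B. B \<in> a \<Longrightarrow> card B \<le> 2"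
    using assms(1) by (auto simp: partial_brauer_def partitions_def)
  obtain B where B: "B \<in> a" "s \<in> B" "t \<in> B" using assms(2) by (auto simp: links_def)
  have "r \<in> B" using links_class[OF p(1) B(1,2)] assms(3) by blast
  hence "{s, t, r} \<subseteq> B" using B by blast
  moreover have "finite B"
  proof (rule finite_subset)
    show "B \<subseteq> verts n" using p(1) B(1) by (auto simp: partition_on_def)
    show "finite (verts n)" by (simp add: verts_def)
  qed
  ultimately have "card {s, t, r} \<le> card B" by (intro card_mono)
  moreover have "card {s, t, r} = 3" using ne by auto
  ultimately show False using p(2)[OF B(1)] by simp
qed

text \<open>Stated for any \<open>S\<close> containing the two witnesses, so that it covers partial
  Brauer and Motzkin monoids alike. It is the left half of tightness that fails.\<close>

lemma loose_partial_brauer: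
  assumes n: "n \<ge> 2" and S: "S \<subseteq> partial_brauer n"
    and mem: "single_pair (verts n) (Upper 1) (Upper 2) \<in> S" "singletons (verts n) \<in> S"
  shows "loose S (pmult n) (canonical_twisting n)"
proof -
  let ?a = "single_pair (verts n) (Upper 1) (Upper 2)" and ?b = "singletons (verts n)"
  have SP: "S \<subseteq> partitions n" using S by (auto simp: partial_brauer_def)
  have ab: "?a \<in> partitions n" "?b \<in> partitions n" using mem SP by auto
  have False if a': "a' \<in> S" and eq: "pmult n ?a ?b = pmult n a' ?b" and zero: "canonical_twisting n a' ?b = 0" for a'
  proof -
    have a'P: "a' \<in> partitions n" and a'B: "a' \<in> partial_brauer n" using a' SP S by auto
    note star = rtrancl_product_rel_singletons[OF a'P]
    have sym: "(t, s) \<in> links a'" if "(s, t) \<in> links a'" for s t using that by (auto simp: links_def)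
    have "floating (Middle ` {1..n}) (product_rel a' ?b) = {}"
      using zero finite_floating[of "Middle ` {1..n}" "product_rel a' ?b"]
      unfolding canonical_twisting_eq[OF a'P ab(2)] by simp
    \<comment> \<open>The component of the middle vertex \<open>i\<close> does not float, so its
      block in \<open>a'\<close> contains a vertex that stays outside the middle row, that is, an
      upper one.\<close>
    have "\<exists>j\<in>{1..n}. (Lower i, Upper j) \<in> links a'" if i: "i \<in> {1..n}" for i
    proof -
      have "\<not> (product_rel a' ?b)\<^sup>* `` {Middle i} \<subseteq> Middle ` {1..n}"
        using floatingI[of "product_rel a' ?b" "Middle i"] \<open>floating _ _ = {}\<close> by blast
      then obtain w where w: "(lower_to_middle (Lower i), w) \<in> (product_rel a' ?b)\<^sup>*" "w \<notin> Middle ` {1..n}"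
        by auto
      then obtain v where v: "(Lower i, v) \<in> links a'" "w = lower_to_middle v" using star[of "Lower i" w] i by auto
      moreover have "v \<in> verts n" using v(1) partitionsD(3)[OF a'P] by blast
      ultimately show ?thesis using w(2) by (cases v) auto
    qed
    then obtain j where j: "\<And>i. i \<in> {1..n} \<Longrightarrow> j i \<in> {1..n} \<and> (Lower i, Upper (j i)) \<in> links a'" by metis
    \<comment> \<open>Two lower vertices with the same upper partner would form a block with three
      elements.\<close>
    have "inj_on j {1..n}"
    proof (rule inj_onI)
      fix i i' assume "i \<in> {1..n}" "i' \<in> {1..n}" "j i = j i'"
      hence "(Upper (j i), Lower i) \<in> links a'" "(Upper (j i), Lower i') \<in> links a'" using j sym by metis+
      thus "i = i'" using partial_brauer_links[OF a'B] by blast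
    qed
    moreover have "j ` {1..n} \<subseteq> {1..n}" using j by blast
    ultimately have "j ` {1..n} = {1..n}" by (meson endo_inj_surj finite_atLeastAtMost)
    \<comment> \<open>By finiteness \<open>j\<close> is onto, so \<open>Upper 1\<close> has a lower
      partner; the product, however, forces its partner to be \<open>Upper 2\<close>.\<close>
    then obtain i where "i \<in> {1..n}" "j i = 1" using n by (metis (no_types) atLeastAtMost_iff imageE one_le_numeral order_trans order_refl)
    hence i: "(Upper 1, Lower i) \<in> links a'" using j sym by metis
    have "(Upper 1, Upper 2) \<in> links ?a" by (simp add: single_pair_def links_insert)
    hence "map_prod lower_to_middle lower_to_middle (Upper 1, Upper 2) \<in> product_rel ?a ?b"
      unfolding product_rel_def by blast
    hence "(Upper 1, Upper 2) \<in> links (pmult n ?a ?b)" unfolding links_pmult[OF ab] using n by auto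
    hence "(lower_to_middle (Upper 1), Upper 2) \<in> (product_rel a' ?b)\<^sup>*"
      unfolding eq links_pmult[OF a'P ab(2)] by simp
    then obtain v where v: "(Upper 1, v) \<in> links a'" "Upper 2 = lower_to_middle v" using star[of "Upper 1" "Upper 2"] n by auto
    hence "v = Upper 2" by (cases v) auto
    thus False using partial_brauer_links[OF a'B v(1) i] by simp
  qed
  hence "\<not> tight S (pmult n) (canonical_twisting n)" using mem unfolding tight_def by blast
  moreover have "twisting S (pmult n) (canonical_twisting n)"
    using twisting_canonical[of n] SP unfolding twisting_def by blast
  ultimately show ?thesis by (simp add: loose_def)
qed

lemma singletons_partial_brauer: "singletons (verts n) \<in> partial_brauer n"
  using partition_on_singletons[of "verts n"] by (auto simp: partial_brauer_def partitions_def singletons_def)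

lemma single_pair_partial_brauer:
  assumes "n \<ge> 2"
  shows "single_pair (verts n) (Upper 1) (Upper 2) \<in> partial_brauer n"
  using assms partition_on_single_pair[of "Upper 1" "verts n" "Upper 2"]
  by (auto simp: partial_brauer_def partitions_def single_pair_def singletons_def)

section \<open>Planar partitions are the noncrossing partitions\<close>

text \<open>
  The upper row goes to the negative and the lower row to the positive real axis, in the order given
  by \<open>vertex_order\<close>.
\<close>

definition polar :: "real ^ 2 \<Rightarrow> real ^ 2" where
  "polar z = (\<chi> i. if i = 1 then z $ 1 * cos (pi * z $ 2) else z $ 1 * sin (pi * z $ 2))"

lemma polar_nth [simp]: "polar z $ 1 = z $ 1 * cos (pi * z $ 2)" "polar z $ 2 = z $ 1 * sin (pi * z $ 2)"
  by (simp_all add: polar_def)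

lemma vec_eq_iff_2: "x = y \<longleftrightarrow> x $ 1 = y $ 1 \<and> x $ 2 = y $ 2" for x y :: "'a ^ 2"
  by (simp add: vec_eq_iff forall_2)

lemma continuous_on_vec_if:
  fixes f g :: "'a::topological_space \<Rightarrow> real"
  assumes "continuous_on S f" "continuous_on S g"
  shows "continuous_on S (\<lambda>x. (\<chi> i. if i = 1 then f x else g x) :: real ^ 2)"
proof (rule continuous_on_vec_lambda)
  fix i :: 2
  show "continuous_on S (\<lambda>x. if i = 1 then f x else g x)"
    using assms by (cases "i = 1") auto
qed

lemma continuous_on_polar: "continuous_on S polar"
  unfolding polar_def by (intro continuous_on_vec_if continuous_intros)

lemma mem_rectangle: "z \<in> rectangle n \<longleftrightarrow> 1 \<le> z $ 1 \<and> z $ 1 \<le> real n \<and> 0 \<le> z $ 2 \<and> z $ 2 \<le> 1"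
  by (auto simp: rectangle_def mem_box_cart forall_2)

lemma rectangle_angle:
  assumes "z \<in> rectangle n"
  shows "0 \<le> pi * z $ 2" "pi * z $ 2 \<le> pi"
proof -
  have "0 \<le> z $ 2" "z $ 2 \<le> 1" using assms by (simp_all add: mem_rectangle)
  thus "0 \<le> pi * z $ 2" "pi * z $ 2 \<le> pi" by (simp_all add: mult_left_le)
qed

text \<open>The radius is positive and hence determined by the absolute value; the angle lies in
  \<open>[0, pi]\<close>, where the cosine is injective.\<close>

lemma inj_on_polar: "inj_on polar (rectangle n)"
proof (rule inj_onI)
  fix z w assume z: "z \<in> rectangle n" and w: "w \<in> rectangle n" and eq: "polar z = polar w"
  have norm: "(polar z $ 1)\<^sup>2 + (polar z $ 2)\<^sup>2 = (z $ 1)\<^sup>2" for z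
    using sin_cos_squared_add2[of "pi * z $ 2"]
    by (simp add: power_mult_distrib distrib_left[symmetric])
  have "(z $ 1)\<^sup>2 = (w $ 1)\<^sup>2" using norm[of z] norm[of w] eq by simp
  hence 1: "z $ 1 = w $ 1" using z w by (simp add: mem_rectangle)
  have "polar z $ 1 = polar w $ 1" using eq by simp
  hence "cos (pi * z $ 2) = cos (pi * w $ 2)" using 1 z by (simp add: mem_rectangle)
  with rectangle_angle[OF z] rectangle_angle[OF w] have "pi * z $ 2 = pi * w $ 2" by (rule cos_inj_pi)
  hence "z $ 2 = w $ 2" by simp
  thus "z = w" using 1 by (simp add: vec_eq_iff_2)
qed

lemma polar_position:
  assumes "v \<in> verts n"
  shows "polar (position v) $ 1 = real_of_int (vertex_order v)" "polar (position v) $ 2 = 0"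
    "position v \<in> rectangle n"
  using assms by (cases v; simp add: mem_rectangle)+

lemma inj_on_position: "inj_on position (verts n)"
proof (rule inj_onI)
  fix u v assume uv: "u \<in> verts n" "v \<in> verts n" "position u = position v"
  hence "vertex_order u = vertex_order v" using polar_position(1)[OF uv(1)] polar_position(1)[OF uv(2)] by simp
  thus "u = v" using inj_on_vertex_order uv by (meson inj_onD)
qed

section \<open>Drawings without crossings give noncrossing partitions\<close>

lemma represents_links:
  assumes "represents n E p"
  shows "links p = {(u, v). u \<in> verts n \<and> v \<in> verts n \<and> (u, v) \<in> {(x, y). {x, y} \<in> E}\<^sup>*}"
proof -
  have "sym {(x, y). {x, y} \<in> E}" by (auto simp: sym_def insert_commute)
  hence s: "sym ({(x, y). {x, y} \<in> E}\<^sup>*)" by (rule sym_rtrancl)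
  have "equiv (verts n) {(u, v). u \<in> verts n \<and> v \<in> verts n \<and> (u, v) \<in> {(x, y). {x, y} \<in> E}\<^sup>*}"
    by (intro equivI refl_onI symI transI) (auto intro: rtrancl_trans dest: symD[OF s])
  from links_quotient[OF this] show ?thesis
    using assms by (simp add: represents_def components_def)
qed

text \<open>Two interleaved blocks would yield two paths inside disjoint parts of the drawing. After
  bending by \<open>polar\<close> their ends interlace on the real axis, so the paths must
  meet.\<close>

lemma planar_imp_noncrossing:
  assumes p: "p \<in> partitions n" and E: "represents n E p" and draw: "crossing_free_drawing n E \<gamma>"
  shows "noncrossing p"
proof (rule ccontr)
  let ?o = vertex_order
  \<comment> \<open>The drawing of the subgraph on \<open>A\<close>; the points of \<open>A\<close>
    themselves are included for the sake of vertices without edges.\<close>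
  define region where "region A = position ` A \<union> (\<Union>e\<in>{e \<in> E. e \<subseteq> A}. path_image (\<gamma> e))" for A
  assume "\<not> noncrossing p"
  then obtain s t u v where o: "?o s < ?o t" "?o t < ?o u" "?o u < ?o v"
    and su: "(s, u) \<in> links p" and tv: "(t, v) \<in> links p" and st: "(s, t) \<notin> links p"
    unfolding noncrossing_def by blast
  have V: "s \<in> verts n" "t \<in> verts n" "u \<in> verts n" "v \<in> verts n"
    using su tv partitionsD(3)[OF p] by auto
  have symp: "(y, x) \<in> links p" if "(x, y) \<in> links p" for x y using that by (auto simp: links_def)
  have transp: "(x, z) \<in> links p" if "(x, y) \<in> links p" "(y, z) \<in> links p" for x y z
    using partitionsD(2)[OF p] that by (meson equivE transD)
  have edge: "arc (\<gamma> e)" "path_image (\<gamma> e) \<subseteq> rectangle n" "{pathstart (\<gamma> e), pathfinish (\<gamma> e)} = position ` e"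
    "path_image (\<gamma> e) \<inter> position ` verts n = position ` e" if "e \<in> E" for e
    using draw that by (auto simp: crossing_free_drawing_def)
  have edges: "path_image (\<gamma> e) \<inter> path_image (\<gamma> f) \<subseteq> position ` (e \<inter> f)" if "e \<in> E" "f \<in> E" "e \<noteq> f" for e f
    using draw that by (auto simp: crossing_free_drawing_def)
  have Everts: "e \<subseteq> verts n" "e \<noteq> {}" if "e \<in> E" for e using E that by (auto simp: represents_def)
  have sub: "region A \<subseteq> rectangle n" if "A \<subseteq> verts n" for A
    unfolding region_def using that polar_position(3) edge(2) by blast
  \<comment> \<open>Drawn edges meet each other and the vertices only in their own end points, so
    disjoint vertex sets have disjoint drawings.\<close>
  have disj: "region A \<inter> region B = {}" if A: "A \<subseteq> verts n" and B: "B \<subseteq> verts n" and AB: "A \<inter> B = {}" for A B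
  proof -
    have pos: "position ` A \<inter> position ` B = {}" using AB A B inj_on_position[of n]
      by (metis image_empty inj_on_image_Int)
    have vert_edge: "position ` C \<inter> path_image (\<gamma> e) = {}"
      if "C \<subseteq> verts n" "e \<in> E" "e \<subseteq> D" "D \<subseteq> verts n" "C \<inter> D = {}" for C D e
    proof -
      have "position ` C \<inter> path_image (\<gamma> e) \<subseteq> position ` C \<inter> position ` e" using edge(4)[OF that(2)] that(1) by blast
      also have "\<dots> = position ` (C \<inter> e)" using inj_on_image_Int[OF inj_on_position] that by (metis subset_trans)
      finally show ?thesis using that(3,5) by blast
    qed
    have edge_edge: "path_image (\<gamma> e) \<inter> path_image (\<gamma> f) = {}" if "e \<in> E" "e \<subseteq> A" "f \<in> E" "f \<subseteq> B" for e f
    proof -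
      have "e \<inter> f = {}" using that AB by blast
      moreover from this have "e \<noteq> f" using Everts(2)[OF that(1)] by blast
      ultimately show ?thesis using edges[OF that(1,3)] by simp
    qed
    let ?U = "\<lambda>A. \<Union>e\<in>{e \<in> E. e \<subseteq> A}. path_image (\<gamma> e)"
    have "position ` A \<inter> ?U B = {}"
      using vert_edge[OF A _ _ B AB] by (simp add: Int_UN_distrib)
    moreover have "?U A \<inter> position ` B = {}"
      using vert_edge[OF B _ _ A] AB by (simp add: Int_UN_distrib Int_commute)
    moreover have "?U A \<inter> ?U B = {}"
      using edge_edge by (simp add: Int_UN_distrib2)
    ultimately show ?thesis using pos by (simp add: region_def Int_Un_distrib Int_Un_distrib2)
  qed
  have conn: "path_component (region (links p `` {x})) (position x) (position y)" if xy: "(x, y) \<in> links p" for x y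
  proof -
    have "(x, y) \<in> {(x, y). {x, y} \<in> E}\<^sup>*" using xy unfolding represents_links[OF E] by blast
    hence "(x, y) \<in> links p \<and> path_component (region (links p `` {x})) (position x) (position y)"
    proof induction
      case base
      have "(x, x) \<in> links p" using xy transp symp by blast
      thus ?case by (auto simp: region_def intro!: path_component_refl)
    next
      case (step y z)
      hence yz: "{y, z} \<in> E" by simp
      hence yzV: "y \<in> verts n" "z \<in> verts n" using Everts by blast+
      have "(y, z) \<in> links p" unfolding represents_links[OF E] using yz yzV by auto
      hence xz: "(x, z) \<in> links p" using step.IH transp by blast
      have im: "path_image (\<gamma> {y, z}) \<subseteq> region (links p `` {x})"
        unfolding region_def using yz step.IH xz by blast
      have "path_component (path_image (\<gamma> {y, z})) (pathstart (\<gamma> {y, z})) (pathfinish (\<gamma> {y, z}))"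
        unfolding path_component_def using arc_imp_path[OF edge(1)[OF yz]] by blast
      hence pc: "path_component (region (links p `` {x})) (pathstart (\<gamma> {y, z})) (pathfinish (\<gamma> {y, z}))"
        by (rule path_component_of_subset[OF im])
      have "{pathstart (\<gamma> {y, z}), pathfinish (\<gamma> {y, z})} = {position y, position z}" using edge(3)[OF yz] by simp
      hence "path_component (region (links p `` {x})) (position y) (position z)"
        using pc path_component_sym[OF pc] by (auto simp: doubleton_eq_iff)
      thus ?case using xz step.IH path_component_trans by blast
    qed
    thus ?thesis by blast
  qed
  obtain f where f: "path f" "path_image f \<subseteq> region (links p `` {s})" "pathstart f = position s" "pathfinish f = position u"
    using conn[OF su] unfolding path_component_def by blast
  obtain g where g: "path g" "path_image g \<subseteq> region (links p `` {t})" "pathstart g = position t" "pathfinish g = position v"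
    using conn[OF tv] unfolding path_component_def by blast
  have regs: "links p `` {s} \<subseteq> verts n" "links p `` {t} \<subseteq> verts n" "links p `` {s} \<inter> links p `` {t} = {}"
    using partitionsD(3)[OF p] st transp symp by blast+
  have fr: "path_image f \<subseteq> rectangle n" and gr: "path_image g \<subseteq> rectangle n"
    using f(2) g(2) sub regs by blast+
  \<comment> \<open>The upper half disc of radius \<open>n\<close> fits into this box, and the four
    end points lie on its bottom side in the order that \<open>fashoda_interlace\<close>
    requires.\<close>
  let ?a = "vector [- real n, 0] :: real ^ 2" and ?b = "vector [real n, real n] :: real ^ 2"
  have box: "polar z \<in> cbox ?a ?b" if z: "z \<in> rectangle n" for z
  proof -
    have 1: "0 \<le> z $ 1" "z $ 1 \<le> real n" using z by (auto simp: mem_rectangle)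
    have "0 \<le> sin (pi * z $ 2)" using rectangle_angle[OF z] by (rule sin_ge_zero)
    moreover have "z $ 1 * sin (pi * z $ 2) \<le> real n * 1" using 1 \<open>0 \<le> sin _\<close> by (intro mult_mono) auto
    moreover have "\<bar>z $ 1 * cos (pi * z $ 2)\<bar> \<le> real n * 1" unfolding abs_mult using 1 by (intro mult_mono) auto
    ultimately show ?thesis using 1 by (auto simp: mem_box_cart forall_2)
  qed
  have pf: "path (polar \<circ> f)" "path (polar \<circ> g)" using f(1) g(1) by (auto intro: path_continuous_image continuous_on_polar)
  obtain z where "z \<in> path_image (polar \<circ> f)" "z \<in> path_image (polar \<circ> g)"
  proof (rule fashoda_interlace[OF pf, of ?a ?b])
    show "path_image (polar \<circ> f) \<subseteq> cbox ?a ?b" "path_image (polar \<circ> g) \<subseteq> cbox ?a ?b"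
      unfolding path_image_compose using fr gr box by blast+
  qed (use o in \<open>simp_all add: pathstart_compose pathfinish_compose f g polar_position[OF V(1)] polar_position[OF V(2)]
      polar_position[OF V(3)] polar_position[OF V(4)] del: polar_nth\<close>)
  then obtain z1 z2 where z: "z1 \<in> path_image f" "z2 \<in> path_image g" "polar z1 = polar z2"
    unfolding path_image_compose by force
  hence "z1 = z2" using inj_onD[OF inj_on_polar z(3)] fr gr by blast
  thus False using z f(2) g(2) disj[OF regs] by blast
qed

section \<open>Drawing noncrossing partitions with half circles\<close>

text \<open>
  The preimage under \<open>polar\<close> of the upper half circle with diameter \<open>[s, t]\<close>. Its real part is linear
  in the parameter, and so is the square of its absolute value.
\<close>

definition half_circle :: "real \<Rightarrow> real \<Rightarrow> real \<Rightarrow> real ^ 2" where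
  "half_circle s t \<tau> = (let \<rho> = sqrt ((1 - \<tau>) * s\<^sup>2 + \<tau> * t\<^sup>2) in
     (\<chi> i. if i = 1 then \<rho> else arccos ((s + (t - s) * \<tau>) / \<rho>) / pi))"

context
  fixes s t :: real and n :: nat
  assumes st: "1 \<le> \<bar>s\<bar>" "1 \<le> \<bar>t\<bar>" "\<bar>s\<bar> \<le> real n" "\<bar>t\<bar> \<le> real n" "s < t"
begin

text \<open>The first two bounds keep the radius between 1 and \<open>n\<close>, as a convex
  combination of squares. The third makes the argument of \<open>arccos\<close> admissible; the
  difference of its sides is \<open>\<tau> * (1 - \<tau>) * (t - s)\<^sup>2\<close>.\<close>

lemma half_circle_radius:
  assumes "\<tau> \<in> {0..1}"
  shows "1 \<le> (1 - \<tau>) * s\<^sup>2 + \<tau> * t\<^sup>2" "(1 - \<tau>) * s\<^sup>2 + \<tau> * t\<^sup>2 \<le> (real n)\<^sup>2"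
    "(s + (t - s) * \<tau>)\<^sup>2 \<le> (1 - \<tau>) * s\<^sup>2 + \<tau> * t\<^sup>2"
proof -
  have sq: "1 \<le> s\<^sup>2" "1 \<le> t\<^sup>2" "s\<^sup>2 \<le> (real n)\<^sup>2" "t\<^sup>2 \<le> (real n)\<^sup>2"
    using st power_mono[of 1 "\<bar>s\<bar>" 2] power_mono[of 1 "\<bar>t\<bar>" 2]
      power_mono[of "\<bar>s\<bar>" "real n" 2] power_mono[of "\<bar>t\<bar>" "real n" 2] by simp_all
  have \<tau>: "0 \<le> \<tau>" "0 \<le> 1 - \<tau>" using assms by auto
  have "(1 - \<tau>) * 1 + \<tau> * 1 \<le> (1 - \<tau>) * s\<^sup>2 + \<tau> * t\<^sup>2"
    using \<tau> sq by (intro add_mono mult_left_mono)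
  thus "1 \<le> (1 - \<tau>) * s\<^sup>2 + \<tau> * t\<^sup>2" by simp
  have "(1 - \<tau>) * s\<^sup>2 + \<tau> * t\<^sup>2 \<le> (1 - \<tau>) * (real n)\<^sup>2 + \<tau> * (real n)\<^sup>2"
    using \<tau> sq by (intro add_mono mult_left_mono)
  thus "(1 - \<tau>) * s\<^sup>2 + \<tau> * t\<^sup>2 \<le> (real n)\<^sup>2" by (simp add: algebra_simps)
  have "(1 - \<tau>) * s\<^sup>2 + \<tau> * t\<^sup>2 - (s + (t - s) * \<tau>)\<^sup>2 = \<tau> * (1 - \<tau>) * (t - s)\<^sup>2"
    by (simp add: power2_eq_square algebra_simps)
  moreover have "0 \<le> \<tau> * (1 - \<tau>) * (t - s)\<^sup>2" using \<tau> by simp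
  ultimately show "(s + (t - s) * \<tau>)\<^sup>2 \<le> (1 - \<tau>) * s\<^sup>2 + \<tau> * t\<^sup>2" by linarith
qed

lemma half_circle_cos_bound:
  assumes "\<tau> \<in> {0..1}"
  shows "\<bar>(s + (t - s) * \<tau>) / sqrt ((1 - \<tau>) * s\<^sup>2 + \<tau> * t\<^sup>2)\<bar> \<le> 1"
proof -
  have "\<bar>s + (t - s) * \<tau>\<bar> \<le> sqrt ((1 - \<tau>) * s\<^sup>2 + \<tau> * t\<^sup>2)"
    using half_circle_radius(3)[OF assms] by (intro real_le_rsqrt) simp
  moreover have "0 < sqrt ((1 - \<tau>) * s\<^sup>2 + \<tau> * t\<^sup>2)"
    using half_circle_radius(1)[OF assms] by simp
  ultimately show ?thesis by (simp add: abs_divide divide_le_eq_1)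
qed

text \<open>With \<open>X\<close> for the real part, the second equation is that of the circle with
  diameter \<open>[s, t]\<close>, namely \<open>Y\<^sup>2 = (X - s) * (t - X)\<close>.\<close>

lemma polar_half_circle:
  assumes "\<tau> \<in> {0..1}"
  shows "polar (half_circle s t \<tau>) $ 1 = s + (t - s) * \<tau>"
    and "(polar (half_circle s t \<tau>) $ 2)\<^sup>2 = ((s + (t - s) * \<tau>) - s) * (t - (s + (t - s) * \<tau>))"
proof -
  define X where "X = s + (t - s) * \<tau>"
  define q where "q = (1 - \<tau>) * s\<^sup>2 + \<tau> * t\<^sup>2"
  have q: "0 < q" "0 < sqrt q" using half_circle_radius(1)[OF assms] by (auto simp: q_def)
  have b: "\<bar>X / sqrt q\<bar> \<le> 1" using half_circle_cos_bound[OF assms] by (simp add: X_def q_def)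
  have nth: "half_circle s t \<tau> $ 1 = sqrt q" "half_circle s t \<tau> $ 2 = arccos (X / sqrt q) / pi"
    by (simp_all add: half_circle_def X_def q_def Let_def)
  show "polar (half_circle s t \<tau>) $ 1 = s + (t - s) * \<tau>"
    using cos_arccos_abs[OF b] q by (simp add: nth X_def)
  have "(polar (half_circle s t \<tau>) $ 2)\<^sup>2 = q * (1 - (X / sqrt q)\<^sup>2)"
    using sin_arccos_abs[OF b] q b by (simp add: nth power_mult_distrib abs_square_le_1)
  also have "\<dots> = q - X\<^sup>2" using q by (simp add: power_divide field_simps)
  also have "\<dots> = (X - s) * (t - X)"
    by (simp add: X_def q_def power2_eq_square algebra_simps)
  finally show "(polar (half_circle s t \<tau>) $ 2)\<^sup>2 = ((s + (t - s) * \<tau>) - s) * (t - (s + (t - s) * \<tau>))"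
    by (simp add: X_def)
qed

lemma half_circle_rectangle:
  assumes "\<tau> \<in> {0..1}"
  shows "half_circle s t \<tau> \<in> rectangle n"
proof -
  let ?q = "(1 - \<tau>) * s\<^sup>2 + \<tau> * t\<^sup>2"
  let ?c = "(s + (t - s) * \<tau>) / sqrt ?q"
  have nth: "half_circle s t \<tau> $ 1 = sqrt ?q" "half_circle s t \<tau> $ 2 = arccos ?c / pi"
    by (simp_all add: half_circle_def Let_def)
  have "-1 \<le> ?c" "?c \<le> 1" using half_circle_cos_bound[OF assms] by (simp_all only: abs_le_iff, linarith+)
  hence "0 \<le> arccos ?c" "arccos ?c \<le> pi" using arccos_bounded by blast+
  moreover have "sqrt ?q \<le> real n" using half_circle_radius(2)[OF assms] by (intro real_le_lsqrt) auto
  moreover have "1 \<le> sqrt ?q" using half_circle_radius(1)[OF assms] by simp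
  ultimately show ?thesis unfolding mem_rectangle nth by simp
qed

lemma arc_half_circle: "arc (half_circle s t)"
  unfolding arc_def
proof
  have "continuous_on {0..1} (half_circle s t)"
    unfolding half_circle_def Let_def
  proof (intro continuous_on_vec_if continuous_intros)
    show "\<forall>\<tau>\<in>{0..1}. sqrt ((1 - \<tau>) * s\<^sup>2 + \<tau> * t\<^sup>2) \<noteq> 0"
      using half_circle_radius(1) by fastforce
    show "\<forall>\<tau>\<in>{0..1}. - 1 \<le> (s + (t - s) * \<tau>) / sqrt ((1 - \<tau>) * s\<^sup>2 + \<tau> * t\<^sup>2) \<and>
        (s + (t - s) * \<tau>) / sqrt ((1 - \<tau>) * s\<^sup>2 + \<tau> * t\<^sup>2) \<le> 1"
      using half_circle_cos_bound by (simp only: abs_le_iff) (smt (verit))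
  qed auto
  thus "path (half_circle s t)" by (simp add: path_def)
  show "inj_on (half_circle s t) {0..1}"
  proof (rule inj_onI)
    fix \<sigma> \<tau> assume "\<sigma> \<in> {0..1}" "\<tau> \<in> {0..1}" "half_circle s t \<sigma> = half_circle s t \<tau>"
    hence "s + (t - s) * \<sigma> = s + (t - s) * \<tau>" using polar_half_circle(1) by metis
    thus "\<sigma> = \<tau>" using st by simp
  qed
qed

end

text \<open>\<open>X\<close> is the real part of a common point of the half circles over
  \<open>[s, t]\<close> and \<open>[s', t']\<close>. Two different diameters that do not interleave
  are either nested or share at most one end point.\<close>

lemma half_circles_meet:
  fixes s t s' t' X :: real
  assumes "s \<le> X" "X \<le> t" "s' \<le> X" "X \<le> t'" "s < t" "s' < t'"
    and eq: "(X - s) * (t - X) = (X - s') * (t' - X)"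
    and "\<not> (s < s' \<and> s' < t \<and> t < t')" "\<not> (s' < s \<and> s < t' \<and> t' < t)" "s \<noteq> s' \<or> t \<noteq> t'"
  shows "(X = s \<or> X = t) \<and> (X = s' \<or> X = t')"
proof -
  have nested: "(X = s \<or> X = t) \<and> (X = s' \<or> X = t')"
    if h: "s \<le> s'" "t' \<le> t" "s' \<le> X" "X \<le> t'" "s' < t'" "s \<noteq> s' \<or> t \<noteq> t'"
      "(X - s) * (t - X) = (X - s') * (t' - X)" for s t s' t' :: real
  proof -
    \<comment> \<open>For nested intervals the difference of the two squared heights is a sum of two
      nonnegative products, so both vanish.\<close>
    have "(s' - s) * (t - X) + (X - s') * (t - t') = (X - s) * (t - X) - (X - s') * (t' - X)"
      by (simp add: algebra_simps)
    moreover have "0 \<le> (s' - s) * (t - X)" "0 \<le> (X - s') * (t - t')" using h by simp_all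
    ultimately have "(s' - s) * (t - X) = 0" "(X - s') * (t - t') = 0" using h(7) by linarith+
    thus ?thesis using h by auto
  qed
  show ?thesis
  proof (cases "s \<le> s' \<and> t' \<le> t")
    case True
    thus ?thesis using nested[of s s' t' t] assms by blast
  next
    case not1: False
    show ?thesis
    proof (cases "s' \<le> s \<and> t \<le> t'")
      case True
      thus ?thesis using nested[of s' s t t'] assms by auto
    next
      case False
      \<comment> \<open>Here the intervals lie side by side, so \<open>X\<close> is the right end of
        one and the left end of the other.\<close>
      thus ?thesis using not1 assms by linarith
    qed
  qed
qed

text \<open>
  Joining only consecutive elements of a block keeps the half circles from crossing.
\<close>

definition arcs :: "vertex set set \<Rightarrow> vertex set set" where
  "arcs a = {{u, v} | u v. (u, v) \<in> links a \<and> vertex_order u < vertex_order v \<and>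
     (\<forall>w. (u, w) \<in> links a \<longrightarrow> \<not> (vertex_order u < vertex_order w \<and> vertex_order w < vertex_order v))}"

text \<open>Any two elements of a block are joined by passing through the elements between them, by
  induction on their distance in the order.\<close>

lemma represents_arcs:
  assumes a: "a \<in> partitions n"
  shows "represents n (arcs a) a"
proof -
  let ?o = vertex_order
  let ?E = "{(x, y). {x, y} \<in> arcs a}"
  note p = partitionsD[OF a]
  have sym: "(t, s) \<in> links a" if "(s, t) \<in> links a" for s t using that by (auto simp: links_def)
  have trans: "(s, u) \<in> links a" if "(s, t) \<in> links a" "(t, u) \<in> links a" for s t u
    using p(2) that by (meson equivE transD)
  have E: "(x, y) \<in> links a" if "{x, y} \<in> arcs a" for x y
    using that sym by (auto simp: arcs_def doubleton_eq_iff)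
  have symE: "sym (?E\<^sup>*)" by (intro sym_rtrancl) (auto simp: sym_def insert_commute)
  have up: "(u, v) \<in> ?E\<^sup>*" if "(u, v) \<in> links a" "?o u < ?o v" for u v
    using that
  proof (induction "nat (?o v - ?o u)" arbitrary: u v rule: less_induct)
    case less
    show ?case
    proof (cases "\<exists>w. (u, w) \<in> links a \<and> ?o u < ?o w \<and> ?o w < ?o v")
      case True
      then obtain w where w: "(u, w) \<in> links a" "?o u < ?o w" "?o w < ?o v" by blast
      have "(u, w) \<in> ?E\<^sup>*" using w less.prems by (intro less.hyps) auto
      moreover have "(w, v) \<in> links a" using w(1) less.prems(1) sym trans by blast
      hence "(w, v) \<in> ?E\<^sup>*" using w less.prems by (intro less.hyps) auto
      ultimately show ?thesis by (rule rtrancl_trans)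
    next
      case False
      hence "{u, v} \<in> arcs a" using less.prems unfolding arcs_def by blast
      thus ?thesis by auto
    qed
  qed
  have "(u, v) \<in> links a \<longleftrightarrow> u \<in> verts n \<and> v \<in> verts n \<and> (u, v) \<in> ?E\<^sup>*" for u v
  proof
    assume uv: "(u, v) \<in> links a"
    have V: "u \<in> verts n" "v \<in> verts n" using uv p(3) by auto
    consider "?o u < ?o v" | "?o v < ?o u" | "?o u = ?o v" by linarith
    hence "(u, v) \<in> ?E\<^sup>*"
    proof cases
      case 1
      thus ?thesis using up uv by blast
    next
      case 2
      thus ?thesis using up[OF sym[OF uv]] symE by (meson symD)
    next
      case 3
      hence "u = v" using inj_onD[OF inj_on_vertex_order _ V] by blast
      thus ?thesis by simp
    qed
    thus "u \<in> verts n \<and> v \<in> verts n \<and> (u, v) \<in> ?E\<^sup>*" using V by blast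
  next
    assume h: "u \<in> verts n \<and> v \<in> verts n \<and> (u, v) \<in> ?E\<^sup>*"
    hence "(u, v) \<in> ?E\<^sup>*" by blast
    thus "(u, v) \<in> links a"
    proof induction
      case base
      show ?case using h p(2) by (meson equivE refl_onD)
    next
      case (step y z)
      thus ?case using E trans by blast
    qed
  qed
  hence "links a = {(u, v). u \<in> verts n \<and> v \<in> verts n \<and> (u, v) \<in> ?E\<^sup>*}" by auto
  moreover have "a = verts n // links a"
    using partition_on_eq_quotient[OF p(1)] by (simp add: links_def)
  ultimately have "components (verts n) (arcs a) = a" by (simp add: components_def)
  moreover have "arcs a \<subseteq> {{u, v} | u v. u \<in> verts n \<and> v \<in> verts n \<and> u \<noteq> v}"
    using p(3) unfolding arcs_def by fastforce
  ultimately show ?thesis by (simp add: represents_def)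
qed

lemma arcsE:
  assumes "e \<in> arcs a"
  obtains u v where "e = {u, v}" "(u, v) \<in> links a" "vertex_order u < vertex_order v"
    "\<forall>w. (u, w) \<in> links a \<longrightarrow> \<not> (vertex_order u < vertex_order w \<and> vertex_order w < vertex_order v)"
  using assms unfolding arcs_def by blast

lemma rectangle_eq_position:
  assumes "z \<in> rectangle n" "w \<in> verts n" "polar z $ 1 = real_of_int (vertex_order w)" "polar z $ 2 = 0"
  shows "z = position w"
proof (rule inj_onD[OF inj_on_polar _ assms(1)])
  show "position w \<in> rectangle n" by (rule polar_position(3)[OF assms(2)])
  show "polar z = polar (position w)"
    unfolding vec_eq_iff_2 polar_position(1,2)[OF assms(2)] using assms(3,4) by blast
qed

text \<open>An edge is an unordered pair; minimum and maximum recover its left and right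
  end.\<close>

definition arc_drawing :: "vertex set \<Rightarrow> real \<Rightarrow> real ^ 2" where
  "arc_drawing e = half_circle (real_of_int (Min (vertex_order ` e))) (real_of_int (Max (vertex_order ` e)))"

lemma arc_drawing_pair:
  "vertex_order u < vertex_order v \<Longrightarrow>
    arc_drawing {u, v} = half_circle (real_of_int (vertex_order u)) (real_of_int (vertex_order v))"
  by (simp add: arc_drawing_def)

context
  fixes n u v
  assumes uv: "u \<in> verts n" "v \<in> verts n" "vertex_order u < vertex_order v"
begin

lemma vertex_order_bounds:
  "1 \<le> \<bar>real_of_int (vertex_order u)\<bar>" "1 \<le> \<bar>real_of_int (vertex_order v)\<bar>"
  "\<bar>real_of_int (vertex_order u)\<bar> \<le> real n" "\<bar>real_of_int (vertex_order v)\<bar> \<le> real n"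
  "real_of_int (vertex_order u) < real_of_int (vertex_order v)"
  using uv by (auto simp: verts_def)

lemmas order_polar = polar_half_circle[OF vertex_order_bounds] half_circle_rectangle[OF vertex_order_bounds]

lemma arc_drawing_image:
  assumes "z \<in> path_image (arc_drawing {u, v})"
  shows "z \<in> rectangle n" "real_of_int (vertex_order u) \<le> polar z $ 1" "polar z $ 1 \<le> real_of_int (vertex_order v)"
    "(polar z $ 2)\<^sup>2 = (polar z $ 1 - real_of_int (vertex_order u)) * (real_of_int (vertex_order v) - polar z $ 1)"
proof -
  let ?s = "real_of_int (vertex_order u)" and ?t = "real_of_int (vertex_order v)"
  obtain \<tau> where \<tau>: "\<tau> \<in> {0..1}" "z = half_circle ?s ?t \<tau>"
    using assms by (auto simp: path_image_def arc_drawing_pair[OF uv(3)])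
  note o = order_polar[OF \<tau>(1), folded \<tau>(2)]
  show "z \<in> rectangle n" by (rule o(3))
  define d where "d = (?t - ?s) * \<tau>"
  have "0 \<le> d" "d \<le> ?t - ?s" using \<tau>(1) uv(3) by (simp_all add: d_def mult_left_le)
  thus "?s \<le> polar z $ 1" "polar z $ 1 \<le> ?t" unfolding o(1) d_def[symmetric] by linarith+
  show "(polar z $ 2)\<^sup>2 = (polar z $ 1 - ?s) * (?t - polar z $ 1)" unfolding o(2) o(1) ..
qed

lemma arc_drawing_ends:
  "pathstart (arc_drawing {u, v}) = position u" "pathfinish (arc_drawing {u, v}) = position v"
proof -
  have 0: "(0::real) \<in> {0..1}" and 1: "(1::real) \<in> {0..1}" by auto
  show "pathstart (arc_drawing {u, v}) = position u"
    unfolding pathstart_def arc_drawing_pair[OF uv(3)]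
    using order_polar[OF 0] uv by (intro rectangle_eq_position[of _ n]) (auto simp del: polar_nth)
  show "pathfinish (arc_drawing {u, v}) = position v"
    unfolding pathfinish_def arc_drawing_pair[OF uv(3)]
    using order_polar[OF 1] uv by (intro rectangle_eq_position[of _ n]) (auto simp del: polar_nth)
qed

end

text \<open>Noncrossing blocks and the consecutiveness of the ends of each edge exclude interleaved
  diameters, so \<open>half_circles_meet\<close> confines common points to common ends.\<close>

lemma noncrossing_imp_planar:
  assumes a: "a \<in> partitions n" "noncrossing a"
  shows "crossing_free_drawing n (arcs a) arc_drawing"
  unfolding crossing_free_drawing_def
proof (intro conjI ballI impI)
  note p = partitionsD[OF a(1)]
  fix e assume e: "e \<in> arcs a"
  then obtain u v where uv: "e = {u, v}" "(u, v) \<in> links a" "vertex_order u < vertex_order v" by (rule arcsE)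
  have V: "u \<in> verts n" "v \<in> verts n" using uv(2) p(3) by auto
  note im = arc_drawing_image[OF V uv(3)] and ends = arc_drawing_ends[OF V uv(3)]
  show "arc (arc_drawing e)"
    unfolding uv(1) arc_drawing_pair[OF uv(3)] by (rule arc_half_circle[OF vertex_order_bounds[OF V uv(3)]])
  show "path_image (arc_drawing e) \<subseteq> rectangle n" unfolding uv(1) using im(1) by blast
  show "{pathstart (arc_drawing e), pathfinish (arc_drawing e)} = position ` e" unfolding uv(1) ends by simp
  show "path_image (arc_drawing e) \<inter> position ` verts n = position ` e"
  proof
    show "path_image (arc_drawing e) \<inter> position ` verts n \<subseteq> position ` e"
    proof
      fix z assume z: "z \<in> path_image (arc_drawing e) \<inter> position ` verts n"
      then obtain w where w: "w \<in> verts n" "z = position w" by blast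
      have "(polar z $ 1 - vertex_order u) * (vertex_order v - polar z $ 1) = (polar z $ 2)\<^sup>2"
        using im(4) z uv(1) by simp
      \<comment> \<open>All vertices lie on the real axis, which a half circle meets only at the
        ends of its diameter.\<close>
      hence "(real_of_int (vertex_order w) - vertex_order u) * (vertex_order v - vertex_order w) = 0"
        unfolding w(2) polar_position(1,2)[OF w(1)] by simp
      hence "vertex_order w = vertex_order u \<or> vertex_order w = vertex_order v" by auto
      hence "w = u \<or> w = v" using inj_onD[OF inj_on_vertex_order] w(1) V by blast
      thus "z \<in> position ` e" using uv(1) w(2) by blast
    qed
    show "position ` e \<subseteq> path_image (arc_drawing e) \<inter> position ` verts n"
      using pathstart_in_path_image[of "arc_drawing e"] pathfinish_in_path_image[of "arc_drawing e"] V
      unfolding uv(1) ends by blast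
  qed
next
  note p = partitionsD[OF a(1)]
  fix e f assume e: "e \<in> arcs a" and f: "f \<in> arcs a" and ef: "e \<noteq> f"
  let ?o = "vertex_order"
  obtain u v where uv: "e = {u, v}" "(u, v) \<in> links a" "?o u < ?o v"
    "\<forall>w. (u, w) \<in> links a \<longrightarrow> \<not> (?o u < ?o w \<and> ?o w < ?o v)" using e by (rule arcsE)
  obtain x y where xy: "f = {x, y}" "(x, y) \<in> links a" "?o x < ?o y"
    "\<forall>w. (x, w) \<in> links a \<longrightarrow> \<not> (?o x < ?o w \<and> ?o w < ?o y)" using f by (rule arcsE)
  have V: "u \<in> verts n" "v \<in> verts n" "x \<in> verts n" "y \<in> verts n" using uv(2) xy(2) p(3) by auto
  have inj: "s = t" if "?o s = ?o t" "s \<in> verts n" "t \<in> verts n" for s t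
    using inj_onD[OF inj_on_vertex_order] that by blast
  \<comment> \<open>If the edges interleaved, noncrossing would put \<open>x\<close> into the block
    of \<open>u\<close>, strictly between the consecutive elements \<open>u\<close> and
    \<open>v\<close>. In \<open>c2\<close> the edges exchange roles.\<close>
  have c1: "\<not> (?o u < ?o x \<and> ?o x < ?o v \<and> ?o v < ?o y)"
    using a(2) uv(2,4) xy(2) unfolding noncrossing_def by blast
  have c2: "\<not> (?o x < ?o u \<and> ?o u < ?o y \<and> ?o y < ?o v)"
    using a(2) uv(2) xy(2,4) unfolding noncrossing_def by blast
  have ne: "?o u \<noteq> ?o x \<or> ?o v \<noteq> ?o y" using ef inj V uv(1) xy(1) by blast
  show "path_image (arc_drawing e) \<inter> path_image (arc_drawing f) \<subseteq> position ` (e \<inter> f)"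
  proof
    fix z assume "z \<in> path_image (arc_drawing e) \<inter> path_image (arc_drawing f)"
    hence "z \<in> path_image (arc_drawing {u, v})" "z \<in> path_image (arc_drawing {x, y})" using uv(1) xy(1) by auto
    note im = arc_drawing_image[OF V(1,2) uv(3) this(1)] arc_drawing_image[OF V(3,4) xy(3) this(2)]
    have X: "(polar z $ 1 = ?o u \<or> polar z $ 1 = ?o v) \<and> (polar z $ 1 = ?o x \<or> polar z $ 1 = ?o y)"
      using im(2-4,6-8) uv(3) xy(3) c1 c2 ne by (intro half_circles_meet) (simp_all del: polar_nth)
    hence "(polar z $ 2)\<^sup>2 = 0" using im(4) by (auto simp del: polar_nth)
    hence Y: "polar z $ 2 = 0" by (simp del: polar_nth)
    obtain w where w: "w \<in> {u, v}" "polar z $ 1 = ?o w" using X by blast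
    obtain w' where w': "w' \<in> {x, y}" "polar z $ 1 = ?o w'" using X by blast
    have wV: "w \<in> verts n" "w' \<in> verts n" using w(1) w'(1) V by auto
    have "w = w'" using w(2) w'(2) by (intro inj wV) simp
    hence "w \<in> e \<inter> f" using w(1) w'(1) uv(1) xy(1) by simp
    moreover have "z = position w" by (rule rectangle_eq_position[OF im(1) wV(1) w(2) Y])
    ultimately show "z \<in> position ` (e \<inter> f)" by blast
  qed
qed

text \<open>Transfers the combinatorial results to the monoids defined by drawings, including the
  membership of the two witnesses for looseness.\<close>

lemma planar_partitions_eq: "planar_partitions n = noncrossing_partitions n"
proof (intro set_eqI iffI)
  fix a assume "a \<in> planar_partitions n"
  thus "a \<in> noncrossing_partitions n" unfolding planar_partitions_def using planar_imp_noncrossing by blast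
next
  fix a assume "a \<in> noncrossing_partitions n"
  thus "a \<in> planar_partitions n"
    unfolding planar_partitions_def using represents_arcs noncrossing_imp_planar by blast
qed

theorem proposition4p2:
  fixes n :: nat
  shows
    "(n \<ge> 1 \<longrightarrow>
        tight (partitions n) (pmult n) (canonical_twisting n) \<and>
        tight (brauer n) (pmult n) (canonical_twisting n) \<and>
        tight (planar_partitions n) (pmult n) (canonical_twisting n) \<and>
        tight (temperley_lieb n) (pmult n) (canonical_twisting n)) \<and>
     (n \<ge> 2 \<longrightarrow>
        loose (partial_brauer n) (pmult n) (canonical_twisting n) \<and>
        loose (motzkin n) (pmult n) (canonical_twisting n))"
proof -
  have "loose (partial_brauer n) (pmult n) (canonical_twisting n)" if "n \<ge> 2"
    using that by (intro loose_partial_brauer singletons_partial_brauer single_pair_partial_brauer) auto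
  moreover have "loose (motzkin n) (pmult n) (canonical_twisting n)" if "n \<ge> 2"
  proof (rule loose_partial_brauer[OF that])
    have "partial_brauer n \<subseteq> partitions n" by (auto simp: partial_brauer_def)
    thus "single_pair (verts n) (Upper 1) (Upper 2) \<in> motzkin n" "singletons (verts n) \<in> motzkin n"
      using singletons_partial_brauer single_pair_partial_brauer[OF that]
        noncrossing_singletons noncrossing_single_pair
      unfolding motzkin_def planar_partitions_eq by blast+
  qed (auto simp: motzkin_def)
  ultimately show ?thesis
    using tight_partitions tight_brauer tight_noncrossing tight_noncrossing_brauer
    by (simp add: planar_partitions_eq temperley_lieb_def)
qed

end
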